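(* Let $\Lambda$ be the set of $(m,n,\lambda)\in\mathbb{R}^3$ such that $$n\ge0,\quad 0<m<n+1,\quad m>n,\quad 0<\lambda<\frac{(m-n)(1+m-n)}{m(1-m+n)},\quad (m-n)\Big(1+\frac{2m}{1+m-n}\lambda\Big)-2n\lambda>0 .$$ For each $(m,0,\lambda)\in\Lambda$ there is $n_0=n_0(m,\lambda)>0$ such that for all $n\in(0,n_0)$ with $(m,n,\lambda)\in\Lambda$ the system $$\begin{aligned} \dot p&=-p\Big(q+\lambda pr-\frac{1}{m\lambda}r^m-\frac{2(m-n)}{1+m-n}+\frac{1}{m\lambda}\Big),\\ \dot q&=q\,(1-q-\lambda pr)+\Big(\frac{2}{1+m-n}-1\Big)\lambda pr,\\ n\,\dot r&=r\Big(q+\lambda pr+\frac{m-n}{m\lambda}r^m-\frac{2(m-n)}{1+m-n}-\frac{m-n}{m\lambda}\Big)\end{aligned}$$ admits a heteroclinic orbit $(p,q,r)(\eta)$, $\eta\in\mathbb{R}$, joining the equilibrium $M_0^{m,n,\lambda}$ (as $\eta\to-\infty$) to the equilibrium $M_1^{m,n,\lambda}$ (as $\eta\to+\infty$), with the property $$e^{-2\eta}\left(\big(p(\eta),\,q(\eta),\,r(\eta)\big)-M_0^{m,n,\lambda}\right)\to\kappa\,\vec X_{01}\qquad\text{as }\eta\to-\infty .$$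
   Context: The dot denotes $d/d\eta$. Here $$a=\frac{2}{1+m-n},\qquad A=\Big(1+\frac{2m}{1+m-n}\lambda\Big)^{1/m},\qquad B=\Big(1+\frac{m}{m-n}\Big(1-\frac{2}{1+m-n}\Big)\lambda\Big)^{1/m},$$ $M_0^{m,n,\lambda}=(0,0,A)$, $M_1^{m,n,\lambda}=(0,1,B)$, $\kappa=A^{-n}$, and $$\vec X_{01}=\Big(1,\ (a-1)A\lambda,\ -\frac{aA^2\lambda^2}{(m-n)A^m-2n\lambda}\Big).$$ *)

theory Defs
  imports "HOL-Analysis.Analysis"
begin

text \<open>The parameter called \<open>lambda\<close> in the mathematics is written \<open>l\<close> here. Points
  \<open>(p, q, r)\<close> of the phase space are elements of \<open>real \<times> real \<times> real\<close>.\<close>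

definition Lambda :: "(real \<times> real \<times> real) set" where
  "Lambda = {(m, n, l).
     n \<ge> 0 \<and> 0 < m \<and> m < n + 1 \<and> m > n \<and>
     0 < l \<and> l < (m - n) * (1 + m - n) / (m * (1 - m + n)) \<and>
     (m - n) * (1 + 2 * m / (1 + m - n) * l) - 2 * n * l > 0}"

definition a :: "real \<Rightarrow> real \<Rightarrow> real" where
  "a m n = 2 / (1 + m - n)"

definition A :: "real \<Rightarrow> real \<Rightarrow> real \<Rightarrow> real" where
  "A m n l = (1 + 2 * m / (1 + m - n) * l) powr (1 / m)"

definition B :: "real \<Rightarrow> real \<Rightarrow> real \<Rightarrow> real" where
  "B m n l = (1 + m / (m - n) * (1 - 2 / (1 + m - n)) * l) powr (1 / m)"

definition M0 :: "real \<Rightarrow> real \<Rightarrow> real \<Rightarrow> real \<times> real \<times> real" where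
  "M0 m n l = (0, 0, A m n l)"

definition M1 :: "real \<Rightarrow> real \<Rightarrow> real \<Rightarrow> real \<times> real \<times> real" where
  "M1 m n l = (0, 1, B m n l)"

definition kappa :: "real \<Rightarrow> real \<Rightarrow> real \<Rightarrow> real" where
  "kappa m n l = A m n l powr (- n)"

definition X01 :: "real \<Rightarrow> real \<Rightarrow> real \<Rightarrow> real \<times> real \<times> real" where
  "X01 m n l =
     (1,
      (a m n - 1) * A m n l * l,
      - (a m n * (A m n l)\<^sup>2 * l\<^sup>2 / ((m - n) * A m n l powr m - 2 * n * l)))"

text \<open>Right-hand side of the system as displayed: the third component is the
  expression equated with \<open>n\<close> times the derivative of \<open>r\<close>.\<close>

fun rhs :: "real \<Rightarrow> real \<Rightarrow> real \<Rightarrow> real \<times> real \<times> real \<Rightarrow> real \<times> real \<times> real" where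
  "rhs m n l (p, q, r) =
     (- p * (q + l * p * r - 1 / (m * l) * r powr m - 2 * (m - n) / (1 + m - n) + 1 / (m * l)),
      q * (1 - q - l * p * r) + (2 / (1 + m - n) - 1) * l * p * r,
      r * (q + l * p * r + (m - n) / (m * l) * r powr m
             - 2 * (m - n) / (1 + m - n) - (m - n) / (m * l)))"

text \<open>The half-space \<open>r > 0\<close> is where the real power \<open>r powr m\<close> has its
  mathematical meaning (\<open>powr\<close> is totalised for other arguments).\<close>

definition phase_space :: "(real \<times> real \<times> real) set" where
  "phase_space = {(p, q, r). r > 0}"

definition equilibrium :: "real \<Rightarrow> real \<Rightarrow> real \<Rightarrow> real \<times> real \<times> real \<Rightarrow> bool" where
  "equilibrium m n l X \<longleftrightarrow> X \<in> phase_space \<and> rhs m n l X = (0, 0, 0)"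

definition global_solution :: "real \<Rightarrow> real \<Rightarrow> real \<Rightarrow> (real \<Rightarrow> real \<times> real \<times> real) \<Rightarrow> bool" where
  "global_solution m n l x \<longleftrightarrow>
     (\<forall>\<eta>. x \<eta> \<in> phase_space \<and>
        (\<exists>p' q' r'. (x has_vector_derivative (p', q', r')) (at \<eta>) \<and>
           (p', q', n * r') = rhs m n l (x \<eta>)))"

definition heteroclinic_orbit ::
    "real \<Rightarrow> real \<Rightarrow> real \<Rightarrow> real \<times> real \<times> real \<Rightarrow> real \<times> real \<times> real \<Rightarrow>
       (real \<Rightarrow> real \<times> real \<times> real) \<Rightarrow> bool" where
  "heteroclinic_orbit m n l X Y x \<longleftrightarrow>
     equilibrium m n l X \<and> equilibrium m n l Y \<and> X \<noteq> Y \<and>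
     global_solution m n l x \<and> (x \<longlongrightarrow> X) at_bot \<and> (x \<longlongrightarrow> Y) at_top"

end

theory Submission
  imports Defs
begin

text \<open>Put \<open>\<rho> = ln r\<close>, \<open>R = (r\<^sup>m - 1) / (m \<lambda>)\<close>, \<open>s = \<lambda> p r\<close>, \<open>d = m - n\<close> and \<open>b = a - 1\<close>, so that
  \<open>d (1 + b) = 1 - b\<close>. The system reads \<open>p' = p (R + 1 - b - q - s)\<close>,
  \<open>q' = q (1 - q - s) + b s\<close> and \<open>n \<rho>' = F\<close> with \<open>F = q + s + d R - (1 - b)\<close>.

  Given \<open>\<rho>\<close>, the first two equations are solved explicitly: writing \<open>p = P / Y\<close>, \<open>q = Q / Y\<close> with
  \<open>Y' = (q + s) Y\<close> makes them linear, \<open>P' = (R + 1 - b) P\<close>, \<open>Q' = Q + b \<lambda> P r\<close>, \<open>Y' = Q + \<lambda> P r\<close>; the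
  conditions \<open>P \<sim> \<kappa> e\<^sup>2\<^sup>\<eta>\<close>, \<open>e\<^sup>-\<^sup>\<eta> Q \<rightarrow> 0\<close>, \<open>Y \<rightarrow> 1\<close> at \<open>-\<infinity>\<close> select the solution. It satisfies
  \<open>b \<lambda> p \<le> q \<le> 1\<close>, whence \<open>F \<le> 0\<close> at a fixed low level \<open>\<rho> = \<alpha>0\<close>, while \<open>F \<ge> 0\<close> at \<open>\<rho> = \<alpha> = ln A\<close>.
  The fast equation is repelling in \<open>\<rho>\<close>, so it is solved from \<open>+\<infinity>\<close>, by the bounded solution \<open>u\<close> of
  \<open>u' = (K1 / n) (u - (\<rho> - F / K1))\<close> with \<open>K1\<close> above the Lipschitz constant of \<open>F\<close> in \<open>\<rho>\<close>. The composite
  map preserves \<open>\<alpha>0 \<le> \<rho> \<le> \<alpha>\<close> and contracts in a sup norm with a weight growing like \<open>e\<^sup>K\<^sup>\<eta>\<close>: large \<open>K\<close> makes the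
  feedback through the past of \<open>p, q\<close> small, and small \<open>n\<close> makes the weight harmless for the
  anticipating equation.

  Convergence to \<open>M\<^sub>1\<close> follows from the fact that \<open>d ln p - n \<rho> - 2 d \<eta> + (1 + d) (\<eta> - ln q)\<close> is
  nonincreasing: it forces \<open>p \<rightarrow> 0\<close>, then \<open>q \<rightarrow> 1\<close>, and boundedness of \<open>\<rho>\<close> forces \<open>r \<rightarrow> B\<close>.\<close>

subsection \<open>Comparison, fixed point and asymptotic lemmas on the line\<close>

lemma has_real_derivative_mirror:
  fixes x :: "real \<Rightarrow> real"
  assumes "(x has_real_derivative D) (at (- t))"
  shows "((\<lambda>t. x (- t)) has_real_derivative - D) (at t)"
  using assms DERIV_mirror by blast

lemma eventually_at_bot_mirror:
  "eventually P at_bot \<longleftrightarrow> eventually (\<lambda>t :: real. P (- t)) at_top"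
  by (subst at_bot_mirror) (simp add: eventually_filtermap)

text \<open>Suppose \<open>G t < 0\<close> and take the last time up to \<open>t\<close> at which
  \<open>G\<close> was at least \<open>G t / 2\<close>. It exists because of the limit 0. From then
  on \<open>G\<close> is negative, hence nondecreasing, and cannot drop to
  \<open>G t\<close>.\<close>

lemma nonneg_if_nondecreasing_where_neg:
  fixes G :: "real \<Rightarrow> real"
  assumes lim: "(G \<longlongrightarrow> 0) at_bot"
    and der: "\<And>t. (G has_real_derivative G' t) (at t)"
    and nonneg: "\<And>t. G t < 0 \<Longrightarrow> 0 \<le> G' t"
  shows "0 \<le> G t"
proof (rule ccontr)
  assume "\<not> 0 \<le> G t"
  then have neg: "G t < 0" by simp
  define S where "S = {s. s \<le> t \<and> G t / 2 \<le> G s}"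
  have cont: "continuous_on UNIV G"
    using der by (intro DERIV_continuous_on) (auto intro: has_field_derivative_at_within)
  have "eventually (\<lambda>s. G t / 2 < G s) at_bot"
    using lim neg by (intro order_tendstoD(1)) auto
  then obtain s0 where s0: "\<And>s. s \<le> s0 \<Longrightarrow> G t / 2 < G s"
    by (auto simp: eventually_at_bot_linorder)
  have "min s0 t \<in> S"
    using s0[of "min s0 t"] by (auto simp: S_def)
  then have ne: "S \<noteq> {}" by auto
  have bdd: "bdd_above S" by (auto simp: S_def intro!: bdd_aboveI[of _ t])
  have "closed S"
    unfolding S_def
    by (intro closed_Collect_conj closed_Collect_le continuous_on_const continuous_on_id cont)
  then have "Sup S \<in> S"
    using ne bdd by (rule closed_contains_Sup[rotated 2])
  then have le: "Sup S \<le> t" and ge: "G t / 2 \<le> G (Sup S)"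
    by (auto simp: S_def)
  have "G (Sup S) \<le> G t"
  proof (rule DERIV_nonneg_imp_increasing_open[OF le])
    fix x assume x: "Sup S < x" "x < t"
    then have "x \<notin> S" using cSup_upper[OF _ bdd, of x] by auto
    then have "G x < 0" using x neg by (auto simp: S_def)
    then show "\<exists>y. (G has_real_derivative y) (at x) \<and> 0 \<le> y"
      using der nonneg by blast
  qed (use cont continuous_on_subset in blast)
  then show False using ge neg by simp
qed

lemma nonneg_if_nondecreasing_from_zero:
  fixes G :: "real \<Rightarrow> real"
  assumes "(G \<longlongrightarrow> 0) at_bot"
    and "\<And>t. (G has_real_derivative G' t) (at t)"
    and "\<And>t. 0 \<le> G' t"
  shows "0 \<le> G t"
  using nonneg_if_nondecreasing_where_neg[of G G'] assms by blast

lemma exp_linear_tendsto_0_at_bot: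
  fixes c :: real
  assumes "0 < c"
  shows "((\<lambda>t. exp (c * t)) \<longlongrightarrow> 0) at_bot"
proof (rule filterlim_compose[OF exp_at_bot])
  show "filterlim (\<lambda>t. c * t) at_bot at_bot"
    using assms filterlim_tendsto_pos_mult_at_bot[OF tendsto_const assms filterlim_ident]
    by (simp add: mult.commute)
qed

lemma exp_linear_tendsto_0_at_top:
  fixes c :: real
  assumes "0 < c"
  shows "((\<lambda>t. exp (- (c * t))) \<longlongrightarrow> 0) at_top"
  using exp_linear_tendsto_0_at_bot[OF assms] unfolding filterlim_at_bot_mirror by simp

lemma mono_tendsto_at_bot:
  fixes F :: "real \<Rightarrow> real"
  assumes mono: "\<And>s t. s \<le> t \<Longrightarrow> F s \<le> F t" and bdd: "\<And>t. L \<le> F t"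
  shows "\<exists>x. (F \<longlongrightarrow> x) at_bot"
proof
  have bb: "bdd_below (range F)" using bdd by (auto intro!: bdd_belowI[of _ L])
  show "(F \<longlongrightarrow> Inf (range F)) at_bot"
  proof (rule order_tendstoI)
    fix x assume "x < Inf (range F)"
    then show "eventually (\<lambda>t. x < F t) at_bot"
      using cInf_lower[OF _ bb] by (auto intro!: always_eventually intro: less_le_trans)
  next
    fix x assume "Inf (range F) < x"
    then obtain t where "F t < x" using cInf_less_iff[OF _ bb, of x] by auto
    then show "eventually (\<lambda>s. F s < x) at_bot"
      unfolding eventually_at_bot_linorder using mono le_less_trans by blast
  qed
qed

section \<open>Linear equations solved from \<open>-\<infinity>\<close> or from
  \<open>+\<infinity>\<close>\<close>

text \<open>With \<open>E' = C exp (c t)\<close>, \<open>G + E\<close> is nondecreasing and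
  \<open>G - E\<close> nonincreasing for any primitive \<open>G\<close>. This yields the limit of
  \<open>G\<close> at \<open>-\<infinity>\<close> and, once the limit is subtracted, the bound by
  \<open>E\<close>.\<close>

lemma primitive_from_minus_infinity:
  fixes f :: "real \<Rightarrow> real"
  assumes cont: "\<And>t. isCont f t" and c: "0 < c"
    and bound: "\<And>t. \<bar>f t\<bar> \<le> C * exp (c * t)"
  obtains F where "\<And>t. (F has_real_derivative f t) (at t)" "(F \<longlongrightarrow> 0) at_bot"
    "\<And>t. \<bar>F t\<bar> \<le> C / c * exp (c * t)"
proof -
  obtain G where G: "\<And>t. (G has_real_derivative f t) (at t)"
    using einterval_antiderivative[of "-\<infinity>" "\<infinity>" f] cont
    by (auto simp: has_real_derivative_iff_has_vector_derivative)
  define E where "E = (\<lambda>t. C / c * exp (c * t))"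
  have E: "(E has_real_derivative C * exp (c * t)) (at t)" for t
    unfolding E_def using c by (auto intro!: derivative_eq_intros)
  have E0: "(E \<longlongrightarrow> 0) at_bot"
    unfolding E_def using tendsto_mult[OF tendsto_const[of "C / c"] exp_linear_tendsto_0_at_bot[OF c]]
    by simp
  have "0 \<le> C * exp (c * 0)" using bound[of 0] abs_ge_zero order_trans by blast
  then have "0 \<le> C" by simp
  have up: "G s + E s \<le> G t + E t" if "s \<le> t" for s t
  proof (rule DERIV_nonneg_imp_nondecreasing[of s t "\<lambda>t. G t + E t", OF that])
    fix x show "\<exists>y. ((\<lambda>t. G t + E t) has_real_derivative y) (at x) \<and> 0 \<le> y"
      using DERIV_add[OF G[of x] E[of x]] bound[of x] by (intro exI[of _ "f x + C * exp (c * x)"]) auto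
  qed
  have down: "G t - E t \<le> G s - E s" if "s \<le> t" for s t
  proof (rule DERIV_nonpos_imp_nonincreasing[of s t "\<lambda>t. G t - E t", OF that])
    fix x show "\<exists>y. ((\<lambda>t. G t - E t) has_real_derivative y) (at x) \<and> y \<le> 0"
      using DERIV_diff[OF G[of x] E[of x]] bound[of x] by (intro exI[of _ "f x - C * exp (c * x)"]) auto
  qed
  have Epos: "0 \<le> E t" for t using \<open>0 \<le> C\<close> c by (simp add: E_def)
  \<comment> \<open>The lower bound \<open>G 0 - E 0\<close> is obtained for
    \<open>t \<le> 0\<close>; truncation at 0 makes it global and keeps the limit at
    \<open>-\<infinity>\<close>.\<close>
  have "\<exists>x. ((\<lambda>t. G (min t 0) + E (min t 0)) \<longlongrightarrow> x) at_bot"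
  proof (rule mono_tendsto_at_bot)
    show "G (min s 0) + E (min s 0) \<le> G (min t 0) + E (min t 0)" if "s \<le> t" for s t
      using up that by (simp add: min_def)
    show "G 0 - E 0 \<le> G (min t 0) + E (min t 0)" for t
      using down[of "min t 0" 0] Epos[of "min t 0"] by simp
  qed
  then obtain x where "((\<lambda>t. G (min t 0) + E (min t 0)) \<longlongrightarrow> x) at_bot" by blast
  moreover have "eventually (\<lambda>t. G (min t 0) + E (min t 0) = G t + E t) at_bot"
    unfolding eventually_at_bot_linorder by (auto intro!: exI[of _ 0] simp: min_def)
  ultimately have "((\<lambda>t. G t + E t) \<longlongrightarrow> x) at_bot"
    using tendsto_cong by fast
  from tendsto_diff[OF this E0] have G0: "(G \<longlongrightarrow> x) at_bot" by simp
  define F where "F = (\<lambda>t. G t - x)"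
  have F: "(F has_real_derivative f t) (at t)" for t
    unfolding F_def using G by (auto intro!: derivative_eq_intros)
  have F0: "(F \<longlongrightarrow> 0) at_bot"
    unfolding F_def using tendsto_diff[OF G0 tendsto_const[of x]] by simp
  have fb: "0 \<le> C * exp (c * t) + f t" "0 \<le> C * exp (c * t) - f t" for t
    using bound[of t] by (auto simp: abs_le_iff)
  have "0 \<le> E t + F t" for t
    using tendsto_add[OF E0 F0] fb
    by (intro nonneg_if_nondecreasing_from_zero[OF _ DERIV_add[OF E F]]) auto
  moreover have "0 \<le> E t - F t" for t
    using tendsto_diff[OF E0 F0] fb
    by (intro nonneg_if_nondecreasing_from_zero[OF _ DERIV_diff[OF E F]]) auto
  ultimately have EF: "0 \<le> E t + F t" "0 \<le> E t - F t" for t by blast+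
  have "\<bar>F t\<bar> \<le> E t" for t
    using EF[of t] by linarith
  then have "\<bar>F t\<bar> \<le> C / c * exp (c * t)" for t
    by (simp add: E_def)
  then show ?thesis using that F F0 by blast
qed

text \<open>The solution is the integral of \<open>k exp (k (t - s)) f s\<close> over
  \<open>s \<ge> t\<close>. Reversing time makes it a primitive from \<open>-\<infinity>\<close>,
  and the kernel has mass 1, so the bound of \<open>f\<close> is inherited.\<close>

lemma bounded_backward_solution:
  fixes f :: "real \<Rightarrow> real"
  assumes cont: "\<And>t. isCont f t" and k: "0 < k" and bound: "\<And>t. \<bar>f t\<bar> \<le> C"
  obtains u where "\<And>t. (u has_real_derivative k * (u t - f t)) (at t)" "\<And>t. \<bar>u t\<bar> \<le> C"
proof -
  have "isCont (\<lambda>t. - exp (k * t) * f (- t)) t" for t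
    by (intro continuous_intros isCont_o2[OF _ cont])
  moreover have "\<bar>- exp (k * t) * f (- t)\<bar> \<le> C * exp (k * t)" for t
    using bound[of "- t"] by (simp add: abs_mult)
  ultimately obtain G where G: "\<And>t. (G has_real_derivative - exp (k * t) * f (- t)) (at t)"
    and Gb: "\<And>t. \<bar>G t\<bar> \<le> C / k * exp (k * t)"
    using primitive_from_minus_infinity[OF _ k, of "\<lambda>t. - exp (k * t) * f (- t)" C] by blast
  have refl: "((\<lambda>t. G (- t)) has_real_derivative exp (- (k * t)) * f t) (at t)" for t
    using has_real_derivative_mirror[OF G[of "- t"]] by simp
  define u where "u = (\<lambda>t. - k * exp (k * t) * G (- t))"
  have "(u has_real_derivative k * (u t - f t)) (at t)" for t
    unfolding u_def
    by (rule derivative_eq_intros refl refl[THEN DERIV_cong] | simp)+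
      (simp add: algebra_simps exp_minus)
  moreover have "\<bar>u t\<bar> \<le> C" for t
  proof -
    have "\<bar>u t\<bar> = k * exp (k * t) * \<bar>G (- t)\<bar>" using k by (simp add: u_def abs_mult)
    also have "\<dots> \<le> k * exp (k * t) * (C / k * exp (k * (- t)))"
      using k by (intro mult_left_mono Gb) auto
    also have "\<dots> = C" using k by (simp add: exp_minus)
    finally show ?thesis .
  qed
  ultimately show ?thesis using that by blast
qed

text \<open>\<open>exp (- k t) (v t - u t)\<close> is nonincreasing with limit 0 at
  \<open>+\<infinity>\<close>, hence nonnegative.\<close>

lemma backward_comparison:
  fixes u v :: "real \<Rightarrow> real"
  assumes u: "\<And>t. (u has_real_derivative u' t) (at t)"
    and v: "\<And>t. (v has_real_derivative v' t) (at t)"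
    and lim: "((\<lambda>t. exp (- (k * t)) * (v t - u t)) \<longlongrightarrow> 0) at_top"
    and le: "\<And>t. v' t - k * v t \<le> u' t - k * u t"
  shows "u t \<le> v t"
proof -
  define G where "G = (\<lambda>t. exp (k * t) * (v (- t) - u (- t)))"
  have u2: "((\<lambda>t. u (- t)) has_real_derivative - u' (- t)) (at t)" for t
    by (rule has_real_derivative_mirror[OF u])
  have v2: "((\<lambda>t. v (- t)) has_real_derivative - v' (- t)) (at t)" for t
    by (rule has_real_derivative_mirror[OF v])
  have "0 \<le> G (- t)"
  proof (rule nonneg_if_nondecreasing_from_zero[of G
        "\<lambda>s. exp (k * s) * ((u' (- s) - k * u (- s)) - (v' (- s) - k * v (- s)))"])
    show "(G \<longlongrightarrow> 0) at_bot"
      unfolding G_def using lim by (simp add: filterlim_at_bot_mirror)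
    show "(G has_real_derivative
        exp (k * s) * ((u' (- s) - k * u (- s)) - (v' (- s) - k * v (- s)))) (at s)" for s
      unfolding G_def by (rule derivative_eq_intros u2 v2 | simp)+ (simp add: algebra_simps)
    show "0 \<le> exp (k * s) * ((u' (- s) - k * u (- s)) - (v' (- s) - k * v (- s)))" for s
      using le[of "- s"] by (intro mult_nonneg_nonneg) auto
  qed
  then show ?thesis by (simp add: G_def zero_le_mult_iff)
qed

text \<open>The hypothesis \<open>start\<close> only ensures that the optimal constant is finite.\<close>

lemma self_improving_bound:
  fixes D \<phi> :: "real \<Rightarrow> real"
  assumes \<phi>: "\<And>t. 0 < \<phi> t"
    and start: "\<And>t. \<bar>D t\<bar> \<le> M * \<phi> t"
    and improve: "\<And>M t. 0 \<le> M \<Longrightarrow> (\<And>t. \<bar>D t\<bar> \<le> M * \<phi> t) \<Longrightarrow> \<bar>D t\<bar> \<le> (M / 2 + Y) * \<phi> t"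
  shows "\<bar>D t\<bar> \<le> 2 * Y * \<phi> t"
proof -
  define N where "N = (SUP t. \<bar>D t\<bar> / \<phi> t)"
  have bdd: "bdd_above (range (\<lambda>t. \<bar>D t\<bar> / \<phi> t))"
    using start \<phi> by (intro bdd_aboveI[of _ M]) (auto simp: divide_le_eq)
  have le: "\<bar>D t\<bar> / \<phi> t \<le> N" for t
    unfolding N_def by (rule cSUP_upper[OF _ bdd]) simp
  then have "\<bar>D t\<bar> \<le> N * \<phi> t" for t using \<phi>[of t] by (simp add: divide_le_eq)
  moreover have "0 \<le> N" using le[of 0] \<phi>[of 0] by (meson abs_ge_zero divide_nonneg_pos order_trans)
  ultimately have "\<bar>D t\<bar> \<le> (N / 2 + Y) * \<phi> t" for t using improve by blast
  then have "N \<le> N / 2 + Y"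
    unfolding N_def using \<phi> by (intro cSUP_least) (auto simp: divide_le_eq)
  then have "N * \<phi> t \<le> 2 * Y * \<phi> t" using \<phi>[of t] by simp
  then show ?thesis using \<open>\<bar>D t\<bar> \<le> N * \<phi> t\<close> by linarith
qed

text \<open>Banach's theorem for bounded continuous functions after the substitution
  \<open>(f - hi) / w\<close>. Subtracting \<open>hi\<close> matters because \<open>w\<close> may
  tend to 0: only \<open>f - hi\<close>, not \<open>f\<close>, is controlled by
  \<open>w\<close>.\<close>

lemma weighted_fixed_point:
  fixes T :: "(real \<Rightarrow> real) \<Rightarrow> real \<Rightarrow> real" and w lo hi :: "real \<Rightarrow> real"
  defines "S \<equiv> {f. continuous_on UNIV f \<and> (\<forall>t. lo t \<le> f t \<and> f t \<le> hi t)}"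
  assumes wpos: "\<And>t. 0 < w t" and wcont: "continuous_on UNIV w"
    and hicont: "continuous_on UNIV hi" and hiS: "hi \<in> S"
    and diam: "\<And>t. hi t - lo t \<le> C * w t"
    and maps: "\<And>f. f \<in> S \<Longrightarrow> T f \<in> S"
    and \<theta>: "0 \<le> \<theta>" "\<theta> < 1"
    and contr: "\<And>f g X t. f \<in> S \<Longrightarrow> g \<in> S \<Longrightarrow> 0 \<le> X \<Longrightarrow> (\<And>t. \<bar>f t - g t\<bar> \<le> X * w t) \<Longrightarrow>
       \<bar>T f t - T g t\<bar> \<le> \<theta> * X * w t"
  shows "\<exists>f\<in>S. T f = f"
proof -
  define dec where "dec = (\<lambda>(x :: real \<Rightarrow>\<^sub>C real) t. hi t + w t * apply_bcontfun x t)"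
  define enc where "enc = (\<lambda>f. Bcontfun (\<lambda>t. (f t - hi t) / w t))"
  define Z where "Z = {x :: real \<Rightarrow>\<^sub>C real. \<forall>t. apply_bcontfun x t \<in> {(lo t - hi t) / w t .. 0}}"
  have Ccont: "(\<lambda>t. (f t - hi t) / w t) \<in> bcontfun" if "f \<in> S" for f
  proof (rule bcontfun_normI)
    show "continuous_on UNIV (\<lambda>t. (f t - hi t) / w t)"
      using that wcont hicont wpos by (intro continuous_intros) (auto simp: S_def less_imp_neq[symmetric])
    show "norm ((f t - hi t) / w t) \<le> C" for t
    proof -
      have "\<bar>f t - hi t\<bar> \<le> C * w t" using that diam[of t] unfolding S_def by (auto simp: abs_le_iff) (smt (verit))+
      then show ?thesis using wpos[of t] by (simp add: divide_le_eq)
    qed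
  qed
  have app_enc: "apply_bcontfun (enc f) t = (f t - hi t) / w t" if "f \<in> S" for f t
    using Bcontfun_inverse[OF Ccont[OF that]] by (simp add: enc_def)
  have dec_enc: "dec (enc f) = f" if "f \<in> S" for f
    using app_enc[OF that] wpos by (auto simp: dec_def less_imp_neq[symmetric])
  have enc_Z: "enc f \<in> Z" if "f \<in> S" for f
    using that wpos by (auto simp: Z_def app_enc[OF that] divide_right_mono less_imp_le divide_nonpos_pos S_def)
  have dec_S: "dec x \<in> S" if "x \<in> Z" for x
  proof -
    have "lo t \<le> hi t + w t * apply_bcontfun x t \<and> hi t + w t * apply_bcontfun x t \<le> hi t" for t
    proof -
      have "(lo t - hi t) / w t \<le> apply_bcontfun x t" "apply_bcontfun x t \<le> 0"
        using that by (auto simp: Z_def)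
      then show ?thesis using wpos[of t] by (auto simp: divide_le_eq mult.commute mult_le_0_iff)
    qed
    moreover have "continuous_on UNIV (dec x)"
      unfolding dec_def by (intro continuous_intros hicont wcont) auto
    ultimately show ?thesis by (auto simp: S_def dec_def)
  qed
  have "Z = PiC UNIV (\<lambda>t. {(lo t - hi t) / w t .. 0})"
    by (auto simp: Z_def mem_PiC_iff Pi_iff)
  then have "closed Z" using closed_PiC[of UNIV "\<lambda>t. {(lo t - hi t) / w t .. 0}"] by simp
  then have "complete Z" by (simp add: complete_eq_closed)
  have dist_le: "dist (enc (T (dec x))) (enc (T (dec y))) \<le> \<theta> * dist x y" if "x \<in> Z" "y \<in> Z" for x y
  proof (rule dist_bound)
    fix t
    note S = dec_S[OF that(1)] dec_S[OF that(2)]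
    have "\<bar>dec x t - dec y t\<bar> \<le> dist x y * w t" for t
    proof -
      have "dec x t - dec y t = (apply_bcontfun x t - apply_bcontfun y t) * w t"
        by (simp add: dec_def algebra_simps)
      then show ?thesis
        using wpos[of t] dist_bounded[of x t y] by (auto simp: abs_mult dist_real_def)
    qed
    then have "\<bar>T (dec x) t - T (dec y) t\<bar> \<le> \<theta> * dist x y * w t"
      using contr[OF S] by simp
    then show "dist (apply_bcontfun (enc (T (dec x))) t) (apply_bcontfun (enc (T (dec y))) t) \<le> \<theta> * dist x y"
      using wpos[of t]
      by (simp add: app_enc maps S dist_real_def divide_le_eq flip: diff_divide_distrib)
  qed
  have "\<exists>!x\<in>Z. enc (T (dec x)) = x"
    by (rule Banach_fix[OF \<open>complete Z\<close> _ \<theta>]) (use enc_Z hiS dec_S maps dist_le in auto)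
  then obtain x where x: "x \<in> Z" "enc (T (dec x)) = x" by blast
  then have "T (dec x) = dec x" using dec_enc maps dec_S by metis
  then show ?thesis using dec_S x(1) by blast
qed

section \<open>Asymptotics of perturbed linear equations\<close>

text \<open>Once \<open>g < c \<epsilon> / 2\<close>, \<open>exp (c t) (x - \<epsilon> / 2)\<close>
  is nonincreasing, so \<open>x - \<epsilon> / 2\<close> is at most a decaying exponential.\<close>

lemma limsup_le_0_if_stable:
  fixes x :: "real \<Rightarrow> real"
  assumes der: "eventually (\<lambda>t. (x has_real_derivative x' t) (at t) \<and> x' t \<le> - c * x t + g t) at_top"
    and c: "0 < c" and g: "(g \<longlongrightarrow> 0) at_top" and \<epsilon>: "0 < \<epsilon>"
  shows "eventually (\<lambda>t. x t < \<epsilon>) at_top"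
proof -
  have "eventually (\<lambda>t. g t < c * (\<epsilon> / 2)) at_top"
    using g c \<epsilon> by (intro order_tendstoD(2)) auto
  with der have "eventually (\<lambda>t. (x has_real_derivative x' t) (at t) \<and>
      x' t \<le> - c * (x t - \<epsilon> / 2)) at_top"
    by eventually_elim (auto simp: algebra_simps)
  then obtain T where T: "\<And>t. T \<le> t \<Longrightarrow> (x has_real_derivative x' t) (at t)"
    "\<And>t. T \<le> t \<Longrightarrow> x' t \<le> - c * (x t - \<epsilon> / 2)"
    by (auto simp: eventually_at_top_linorder)
  define y where "y = (\<lambda>t. exp (c * t) * (x t - \<epsilon> / 2))"
  have y: "y t \<le> y T" if "T \<le> t" for t
  proof (rule DERIV_nonpos_imp_nonincreasing[OF that])
    fix s assume s: "T \<le> s" "s \<le> t"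
    have "(y has_real_derivative exp (c * s) * (x' s + c * (x s - \<epsilon> / 2))) (at s)"
      unfolding y_def by (rule derivative_eq_intros T(1)[OF s(1)] | simp)+ (simp add: algebra_simps)
    moreover have "exp (c * s) * (x' s + c * (x s - \<epsilon> / 2)) \<le> 0"
      using T(2)[OF s(1)] by (intro mult_nonneg_nonpos) auto
    ultimately show "\<exists>z. (y has_real_derivative z) (at s) \<and> z \<le> 0" by blast
  qed
  have "((\<lambda>t. y T * exp (- (c * t))) \<longlongrightarrow> y T * 0) at_top"
    by (intro tendsto_intros exp_linear_tendsto_0_at_top c)
  then have "eventually (\<lambda>t. y T * exp (- (c * t)) < \<epsilon> / 2) at_top"
    using \<epsilon> by (intro order_tendstoD(2)) auto
  then show ?thesis using eventually_ge_at_top[of T]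
  proof eventually_elim
    case (elim t)
    have "x t - \<epsilon> / 2 = y t * exp (- (c * t))" by (simp add: y_def exp_minus)
    also have "\<dots> \<le> y T * exp (- (c * t))" using y[OF elim(2)] by simp
    finally show ?case using elim(1) by simp
  qed
qed

text \<open>Here \<open>exp (- c t) (x - \<epsilon> / 2)\<close> is eventually nondecreasing. Were
  it positive once, \<open>x\<close> would grow exponentially, against the bound
  \<open>M\<close>.\<close>

lemma limsup_le_0_if_unstable:
  fixes x :: "real \<Rightarrow> real"
  assumes der: "eventually (\<lambda>t. (x has_real_derivative x' t) (at t) \<and> c * x t - g t \<le> x' t) at_top"
    and bdd: "eventually (\<lambda>t. x t \<le> M) at_top"
    and c: "0 < c" and g: "(g \<longlongrightarrow> 0) at_top" and \<epsilon>: "0 < \<epsilon>"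
  shows "eventually (\<lambda>t. x t < \<epsilon>) at_top"
proof -
  have "eventually (\<lambda>t. g t < c * (\<epsilon> / 2)) at_top"
    using g c \<epsilon> by (intro order_tendstoD(2)) auto
  with der bdd have "eventually (\<lambda>t. (x has_real_derivative x' t) (at t) \<and>
      c * (x t - \<epsilon> / 2) \<le> x' t \<and> x t \<le> M) at_top"
    by eventually_elim (auto simp: algebra_simps)
  then obtain T where T: "\<And>t. T \<le> t \<Longrightarrow> (x has_real_derivative x' t) (at t)"
    "\<And>t. T \<le> t \<Longrightarrow> c * (x t - \<epsilon> / 2) \<le> x' t" "\<And>t. T \<le> t \<Longrightarrow> x t \<le> M"
    by (auto simp: eventually_at_top_linorder)
  define y where "y = (\<lambda>t. exp (- (c * t)) * (x t - \<epsilon> / 2))"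
  have y: "y s \<le> y t" if "T \<le> s" "s \<le> t" for s t
  proof (rule DERIV_nonneg_imp_nondecreasing[OF that(2)])
    fix r assume r: "s \<le> r" "r \<le> t"
    then have "T \<le> r" using that by simp
    have "(y has_real_derivative exp (- (c * r)) * (x' r - c * (x r - \<epsilon> / 2))) (at r)"
      unfolding y_def by (rule derivative_eq_intros T(1)[OF \<open>T \<le> r\<close>] | simp)+ (simp add: algebra_simps)
    moreover have "0 \<le> exp (- (c * r)) * (x' r - c * (x r - \<epsilon> / 2))"
      using T(2)[OF \<open>T \<le> r\<close>] by (intro mult_nonneg_nonneg) auto
    ultimately show "\<exists>z. (y has_real_derivative z) (at r) \<and> 0 \<le> z" by blast
  qed
  have "x s < \<epsilon>" if s: "T \<le> s" for s
  proof (rule ccontr)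
    assume "\<not> x s < \<epsilon>"
    then have pos: "0 < y s" using \<epsilon> by (simp add: y_def)
    have "((\<lambda>t. (M - \<epsilon> / 2) * exp (- (c * t))) \<longlongrightarrow> (M - \<epsilon> / 2) * 0) at_top"
      by (intro tendsto_intros exp_linear_tendsto_0_at_top c)
    then have "eventually (\<lambda>t. (M - \<epsilon> / 2) * exp (- (c * t)) < y s) at_top"
      using pos by (intro order_tendstoD(2)) auto
    then obtain N where "\<And>t. N \<le> t \<Longrightarrow> (M - \<epsilon> / 2) * exp (- (c * t)) < y s"
      by (auto simp: eventually_at_top_linorder)
    then obtain t where t: "s \<le> t" "(M - \<epsilon> / 2) * exp (- (c * t)) < y s"
      by (meson max.cobounded1 max.cobounded2)
    have "y t \<le> (M - \<epsilon> / 2) * exp (- (c * t))"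
      unfolding y_def using T(3)[of t] s t(1) by (simp add: mult.commute)
    then show False using y[OF s t(1)] t(2) by simp
  qed
  then show ?thesis by (auto simp: eventually_at_top_linorder)
qed

lemma tendsto_0_if_square_small:
  fixes x :: "real \<Rightarrow> real"
  assumes "\<And>\<epsilon>. 0 < \<epsilon> \<Longrightarrow> eventually (\<lambda>t. (x t)\<^sup>2 < \<epsilon>) F"
  shows "(x \<longlongrightarrow> 0) F"
proof (rule tendstoI)
  fix \<epsilon> :: real assume "0 < \<epsilon>"
  then have "eventually (\<lambda>t. (x t)\<^sup>2 < \<epsilon>\<^sup>2) F" using assms by simp
  then show "eventually (\<lambda>t. dist (x t) 0 < \<epsilon>) F"
  proof eventually_elim
    case (elim t)
    then have "\<bar>x t\<bar>\<^sup>2 < \<epsilon>\<^sup>2" by simp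
    then show ?case using \<open>0 < \<epsilon>\<close> power2_less_imp_less[of "\<bar>x t\<bar>" \<epsilon>] by simp
  qed
qed

text \<open>The one-sided result is applied to the square of \<open>x\<close>, whose derivative is
  \<open>2 x x'\<close>; this treats both signs of \<open>x\<close> at once.\<close>

lemma unstable_tendsto_0:
  fixes x :: "real \<Rightarrow> real"
  assumes der: "eventually (\<lambda>t. (x has_real_derivative x' t) (at t) \<and>
      c * (x t)\<^sup>2 - g t \<le> x t * x' t) at_top"
    and bdd: "eventually (\<lambda>t. \<bar>x t\<bar> \<le> M) at_top"
    and c: "0 < c" and g: "(g \<longlongrightarrow> 0) at_top"
  shows "(x \<longlongrightarrow> 0) at_top"
proof (rule tendsto_0_if_square_small, rule limsup_le_0_if_unstable)
  show "eventually (\<lambda>t. ((\<lambda>t. (x t)\<^sup>2) has_real_derivative 2 * (x t * x' t)) (at t) \<and>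
      2 * c * (x t)\<^sup>2 - 2 * g t \<le> 2 * (x t * x' t)) at_top"
    using der by eventually_elim (auto intro!: derivative_eq_intros)
  show "eventually (\<lambda>t. (x t)\<^sup>2 \<le> M\<^sup>2) at_top"
    using bdd by eventually_elim (metis abs_ge_zero power2_abs power_mono)
  show "((\<lambda>t. 2 * g t) \<longlongrightarrow> 0) at_top" using tendsto_mult[OF tendsto_const[of 2] g] by simp
qed (use c in auto)

lemma stable_tendsto_0:
  fixes x :: "real \<Rightarrow> real"
  assumes der: "eventually (\<lambda>t. (x has_real_derivative x' t) (at t) \<and>
      x t * x' t \<le> - c * (x t)\<^sup>2 + g t) at_top"
    and c: "0 < c" and g: "(g \<longlongrightarrow> 0) at_top"
  shows "(x \<longlongrightarrow> 0) at_top"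
proof (rule tendsto_0_if_square_small, rule limsup_le_0_if_stable)
  show "eventually (\<lambda>t. ((\<lambda>t. (x t)\<^sup>2) has_real_derivative 2 * (x t * x' t)) (at t) \<and>
      2 * (x t * x' t) \<le> - (2 * c) * (x t)\<^sup>2 + 2 * g t) at_top"
    using der by eventually_elim (auto intro!: derivative_eq_intros)
  show "((\<lambda>t. 2 * g t) \<longlongrightarrow> 0) at_top" using tendsto_mult[OF tendsto_const[of 2] g] by simp
qed (use c in auto)

text \<open>An equation attracting forward in time is repelling towards \<open>-\<infinity>\<close>,
  where boundedness then forces the limit.\<close>

lemma unstable_tendsto_0_at_bot:
  fixes x :: "real \<Rightarrow> real"
  assumes der: "eventually (\<lambda>t. (x has_real_derivative x' t) (at t) \<and>
      x t * x' t \<le> - c * (x t)\<^sup>2 + g t) at_bot"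
    and bdd: "eventually (\<lambda>t. \<bar>x t\<bar> \<le> M) at_bot"
    and c: "0 < c" and g: "(g \<longlongrightarrow> 0) at_bot"
  shows "(x \<longlongrightarrow> 0) at_bot"
  unfolding filterlim_at_bot_mirror
proof (rule unstable_tendsto_0)
  show "eventually (\<lambda>t. ((\<lambda>t. x (- t)) has_real_derivative - x' (- t)) (at t) \<and>
      c * (x (- t))\<^sup>2 - g (- t) \<le> x (- t) * - x' (- t)) at_top"
    using der unfolding eventually_at_bot_mirror
    by eventually_elim (auto intro: has_real_derivative_mirror)
  show "eventually (\<lambda>t. \<bar>x (- t)\<bar> \<le> M) at_top" using bdd by (simp add: eventually_at_bot_mirror)
  show "((\<lambda>t. g (- t)) \<longlongrightarrow> 0) at_top" using g by (simp add: filterlim_at_bot_mirror)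
qed (rule c)

lemma stable_tendsto_0_at_bot:
  fixes x :: "real \<Rightarrow> real"
  assumes der: "eventually (\<lambda>t. (x has_real_derivative x' t) (at t) \<and>
      c * (x t)\<^sup>2 - g t \<le> x t * x' t) at_bot"
    and c: "0 < c" and g: "(g \<longlongrightarrow> 0) at_bot"
  shows "(x \<longlongrightarrow> 0) at_bot"
  unfolding filterlim_at_bot_mirror
proof (rule stable_tendsto_0)
  show "eventually (\<lambda>t. ((\<lambda>t. x (- t)) has_real_derivative - x' (- t)) (at t) \<and>
      x (- t) * - x' (- t) \<le> - c * (x (- t))\<^sup>2 + g (- t)) at_top"
    using der unfolding eventually_at_bot_mirror
    by eventually_elim (auto intro: has_real_derivative_mirror)
  show "((\<lambda>t. g (- t)) \<longlongrightarrow> 0) at_top" using g by (simp add: filterlim_at_bot_mirror)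
qed (rule c)

subsection \<open>The slow equations driven by a given fast variable\<close>

text \<open>The Lipschitz constant is the bound on the exponentials themselves. For positive
  quantities bounded by a multiple of \<open>h\<close>, differences of logarithms thus give
  differences that keep the factor \<open>h\<close>.\<close>

lemma abs_exp_diff_le:
  fixes u v C :: real
  assumes "exp u \<le> C" "exp v \<le> C"
  shows "\<bar>exp u - exp v\<bar> \<le> C * \<bar>u - v\<bar>"
proof -
  have "exp x - exp y \<le> C * \<bar>x - y\<bar>" if "exp x \<le> C" for x y :: real
  proof -
    have "exp x * (1 + (y - x)) \<le> exp x * exp (y - x)"
      by (intro mult_left_mono exp_ge_add_one_self) auto
    then have "exp x - exp y \<le> exp x * (x - y)"
      by (simp add: algebra_simps flip: exp_add)
    also have "\<dots> \<le> exp x * \<bar>x - y\<bar>" by (intro mult_left_mono) auto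
    also have "\<dots> \<le> C * \<bar>x - y\<bar>" by (intro mult_right_mono that) auto
    finally show ?thesis .
  qed
  from this[of u v] this[of v u] assms show ?thesis by (simp add: abs_minus_commute abs_le_iff)
qed

text \<open>Here \<open>\<alpha>\<close> and \<open>\<alpha>0\<close> are the upper and lower barrier for \<open>\<rho> = ln r\<close>; \<open>c\<close> and \<open>k0\<close> are bounds that do
  not depend on \<open>n\<close>, so that \<open>K\<close>, the growth rate of the weight, can be fixed before \<open>n\<close>
  is taken small.\<close>

locale slow_fast =
  fixes m n l b d \<kappa> \<alpha> \<alpha>0 c k0 K :: real
  assumes m: "0 < m" and n: "0 < n" and l: "0 < l" and b: "0 < b" "b < 1"
    and d: "0 < d" "d \<le> 1" and \<kappa>: "0 < \<kappa>" "\<kappa> \<le> 1"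
    and top: "exp (m * \<alpha>) - 1 = (1 + b) * (m * l)" and db: "d * (1 + b) = 1 - b"
    and bottom: "b + exp \<alpha>0 / b + d * ((exp (m * \<alpha>0) - 1) / (m * l)) \<le> 0"
    and c: "1 \<le> c" "exp \<alpha> \<le> c" "1 / b \<le> c" "l \<le> c" "exp (m * \<alpha>) / l \<le> c"
    and k0: "0 < k0" "k0 \<le> d * (exp (m * \<alpha>0) / l)"
    and K: "4 \<le> K" "8 * c\<^sup>2 \<le> K" "28 * (2 * c\<^sup>2)\<^sup>2 \<le> K * k0" "K * n \<le> k0 / 4"
begin

definition R :: "real \<Rightarrow> real" where
  "R x = (exp (m * x) - 1) / (m * l)"

definition F :: "real \<Rightarrow> real \<Rightarrow> real \<Rightarrow> real" where
  "F p q x = q + l * p * exp x + d * R x - (1 - b)"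

text \<open>The logistic solution of \<open>h' = 2 h (1 - h)\<close>: like \<open>exp (2 t)\<close>
  at \<open>-\<infinity>\<close>, the rate at which the orbit leaves \<open>M0\<close>, and
  saturating at 1.\<close>

definition h :: "real \<Rightarrow> real" where
  "h t = exp (2 * t) / (1 + exp (2 * t))"

text \<open>Chosen so that \<open>\<phi>' = K h \<phi>\<close>: integrating \<open>h \<phi>\<close>
  from \<open>-\<infinity>\<close> gains a factor \<open>1 / K\<close>. It tends to 1 at
  \<open>-\<infinity>\<close> and grows like \<open>exp (K t)\<close> at
  \<open>+\<infinity>\<close>.\<close>

definition \<phi> :: "real \<Rightarrow> real" where
  "\<phi> t = (1 + exp (2 * t)) powr (K / 2)"

abbreviation "c2 \<equiv> 2 * c\<^sup>2"
text \<open>Twice the value \<open>2 c2 / k0\<close> that a barrier \<open>\<alpha> - D0 h\<close>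
  would need without the term from its own slope.\<close>

abbreviation "D0 \<equiv> 4 * c2 / k0"

text \<open>The barrier \<open>\<alpha> - D0 h\<close> makes \<open>\<rho>\<close> approach
  \<open>\<alpha>\<close> at rate \<open>exp (2 t)\<close>. This keeps the norm with weight
  \<open>h \<phi>\<close> finite at \<open>-\<infinity>\<close> and yields the exponential rates
  near \<open>M0\<close>.\<close>

definition admissible :: "(real \<Rightarrow> real) \<Rightarrow> bool" where
  "admissible \<rho> \<longleftrightarrow> continuous_on UNIV \<rho> \<and> (\<forall>t. max \<alpha>0 (\<alpha> - D0 * h t) \<le> \<rho> t \<and> \<rho> t \<le> \<alpha>)"

definition driven_by :: "(real \<Rightarrow> real) \<Rightarrow> (real \<Rightarrow> real) \<Rightarrow> (real \<Rightarrow> real) \<Rightarrow> bool" where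
  "driven_by \<rho> p q \<longleftrightarrow> (\<forall>t. 0 < p t \<and> p t \<le> \<kappa> * exp (2 * t) \<and> b * l * p t \<le> q t \<and> q t \<le> 1 \<and>
      q t \<le> b * \<kappa> * l * exp \<alpha> * exp (2 * t) \<and>
      (p has_real_derivative p t * (R (\<rho> t) + 1 - b - (q t + l * p t * exp (\<rho> t)))) (at t) \<and>
      (q has_real_derivative
        q t * (1 - (q t + l * p t * exp (\<rho> t))) + b * (l * p t * exp (\<rho> t))) (at t)) \<and>
    ((\<lambda>t. ln (p t) - 2 * t) \<longlongrightarrow> ln \<kappa>) at_bot"

section \<open>The weights \<open>h\<close> and \<open>\<phi>\<close>\<close>

lemma h_bounds: "0 < h t" "h t < 1" "h t \<le> exp (2 * t)"
  by (auto simp: h_def divide_simps add_pos_pos)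

lemma phi_ge_1: "1 \<le> \<phi> t"
  using K by (simp add: \<phi>_def ge_one_powr_ge_zero)

lemma h_deriv: "(h has_real_derivative 2 * h t * (1 - h t)) (at t)"
proof -
  have "1 + exp (2 * t) \<noteq> 0" by (smt (verit) exp_gt_zero)
  then show ?thesis
    unfolding h_def by (auto intro!: derivative_eq_intros simp: divide_simps) (simp add: algebra_simps)
qed

lemma phi_deriv: "(\<phi> has_real_derivative K * h t * \<phi> t) (at t)"
proof -
  have pos: "0 < 1 + exp (2 * t)" by (smt (verit) exp_gt_zero)
  have "(\<phi> has_real_derivative (1 + exp (2 * t)) powr (K / 2) * (2 * exp (2 * t) * (K / 2) / (1 + exp (2 * t)))) (at t)"
    unfolding \<phi>_def using pos
    by (intro DERIV_cong[OF DERIV_powr[of "\<lambda>t. 1 + exp (2 * t)" "2 * exp (2 * t)" _ "\<lambda>_. K / 2" 0]])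
      (auto intro!: derivative_eq_intros)
  moreover have "(1 + exp (2 * t)) powr (K / 2) * (2 * exp (2 * t) * (K / 2) / (1 + exp (2 * t))) = K * h t * \<phi> t"
    by (simp add: \<phi>_def h_def)
  ultimately show ?thesis by simp
qed

lemma exp2_tendsto_0: "((\<lambda>t :: real. exp (2 * t)) \<longlongrightarrow> 0) at_bot"
  using exp_linear_tendsto_0_at_bot[of 2] by simp

lemma phi_tendsto_1: "(\<phi> \<longlongrightarrow> 1) at_bot"
  unfolding \<phi>_def
  by (rule tendsto_eq_intros exp2_tendsto_0 refl | simp)+

lemma h_tendsto_0: "(h \<longlongrightarrow> 0) at_bot"
  unfolding h_def
  by (rule tendsto_eq_intros exp2_tendsto_0 refl | simp)+

text \<open>\<open>h\<close> is at least half the minimum of \<open>exp (2 t)\<close> and 1.\<close>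

lemma le_2h:
  assumes "y \<le> C * exp (2 * t)" "y \<le> C" "0 \<le> C"
  shows "y \<le> 2 * C * h t"
proof (cases "exp (2 * t) \<le> 1")
  case True
  then have "exp (2 * t) / 2 \<le> h t"
    unfolding h_def by (intro divide_left_mono) (auto intro: add_pos_pos)
  then have "C * exp (2 * t) \<le> C * (2 * h t)" using assms(3) by (intro mult_left_mono) auto
  then show ?thesis using assms by simp
next
  case False
  then have "1 / 2 \<le> h t"
    by (simp add: h_def divide_simps add_pos_pos)
  then have "C * 1 \<le> C * (2 * h t)" using assms(3) by (intro mult_left_mono) auto
  then show ?thesis using assms by simp
qed

section \<open>The nonlinearity \<open>R\<close> between the barriers\<close>

lemma R_top: "R \<alpha> = 1 + b"
  using top m l by (simp add: R_def)

lemma R_deriv: "(R has_real_derivative exp (m * x) / l) (at x)"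
  unfolding R_def using m l by (auto intro!: derivative_eq_intros simp: divide_simps)

lemma R_mono: "x \<le> y \<Longrightarrow> R x \<le> R y"
  unfolding R_def using m l by (intro divide_right_mono diff_mono) auto

lemma alpha0_le: "\<alpha>0 \<le> \<alpha>"
proof -
  have "0 < exp \<alpha>0 / b" using b by simp
  then have "d * R \<alpha>0 < d * 0" using bottom b unfolding R_def by linarith
  then have "R \<alpha>0 < 0" using d by (simp only: mult_less_cancel_left_pos)
  then show ?thesis using R_mono[of \<alpha> \<alpha>0] R_top b by linarith
qed

lemma R_cont: "isCont R x"
  using R_deriv DERIV_isCont by blast

text \<open>From \<open>R \<alpha> = 1 + b\<close> the left side is at most 1, and for negative
  \<open>x\<close> it is negative. This inequality keeps \<open>q - b l p\<close> nonnegative along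
  driven solutions.\<close>

lemma R_minus_b_le: "x \<le> \<alpha> \<Longrightarrow> R x - b \<le> exp x"
proof (cases "0 \<le> x")
  case True
  assume "x \<le> \<alpha>"
  then have "R x \<le> 1 + b" using R_mono R_top by metis
  then show ?thesis using True one_le_exp_iff[of x] by linarith
next
  case False
  then have "R x \<le> R 0" by (intro R_mono) auto
  moreover have "R 0 = 0" by (simp add: R_def)
  ultimately show ?thesis using b exp_gt_zero[of x] by linarith
qed

text \<open>Mean value form with slope bounds uniform between the barriers: the upper one serves
  Lipschitz estimates, the lower one is the expansion rate of the fast equation.\<close>

lemma R_diff:
  assumes "\<alpha>0 \<le> x" "x \<le> \<alpha>" "\<alpha>0 \<le> y" "y \<le> \<alpha>"
  obtains g where "k0 \<le> d * g" "0 \<le> g" "g \<le> c" "R x - R y = g * (x - y)"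
proof -
  have *: "k0 \<le> d * (exp (m * z) / l) \<and> 0 \<le> exp (m * z) / l \<and> exp (m * z) / l \<le> c"
    if "\<alpha>0 \<le> z" "z \<le> \<alpha>" for z
  proof (intro conjI)
    have "exp (m * \<alpha>0) / l \<le> exp (m * z) / l" using that m l by (intro divide_right_mono) auto
    then have "d * (exp (m * \<alpha>0) / l) \<le> d * (exp (m * z) / l)" using d by (intro mult_left_mono) auto
    then show "k0 \<le> d * (exp (m * z) / l)" using k0 by linarith
    have "exp (m * z) / l \<le> exp (m * \<alpha>) / l" using that m l by (intro divide_right_mono) auto
    then show "exp (m * z) / l \<le> c" using c by linarith
    show "0 \<le> exp (m * z) / l" using l by simp
  qed
  consider "x < y" | "y < x" | "x = y" by linarith
  then show ?thesis
  proof cases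
    case 1
    obtain z where "x < z" "z < y" "R y - R x = (y - x) * (exp (m * z) / l)"
      using MVT2[OF 1 R_deriv] by blast
    then have "R x - R y = exp (m * z) / l * (x - y)" by (metis minus_diff_eq mult.commute mult_minus_right)
    then show ?thesis using *[of z] assms \<open>x < z\<close> \<open>z < y\<close> by (intro that[of "exp (m * z) / l"]) auto
  next
    case 2
    obtain z where "y < z" "z < x" "R x - R y = (x - y) * (exp (m * z) / l)"
      using MVT2[OF 2 R_deriv] by blast
    then show ?thesis using *[of z] assms by (intro that[of "exp (m * z) / l"]) (auto simp: algebra_simps)
  next
    case 3
    then show ?thesis using *[of x] assms by (intro that[of "exp (m * x) / l"]) auto
  qed
qed

section \<open>The driven solution and its bounds\<close>

lemma admissibleD:
  assumes "admissible \<rho>"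
  shows "isCont \<rho> t" "\<alpha>0 \<le> \<rho> t" "\<rho> t \<le> \<alpha>" "\<alpha> - \<rho> t \<le> D0 * h t"
  using assms by (auto simp: admissible_def continuous_on_eq_continuous_at algebra_simps)

lemma admissible_bounds:
  assumes "admissible \<rho>"
  shows "exp (\<rho> t) \<le> exp \<alpha>" "exp (\<rho> t) \<le> c"
proof -
  show "exp (\<rho> t) \<le> exp \<alpha>" using admissibleD(3)[OF assms, of t] by simp
  then show "exp (\<rho> t) \<le> c" using c by linarith
qed

lemma D0_nonneg: "0 \<le> D0"
  using k0 by simp

text \<open>\<open>P\<close>, \<open>Q\<close> and \<open>Y\<close> are found one after the other by
  integration from \<open>-\<infinity>\<close>; the barriers for \<open>p\<close> and
  \<open>q\<close> become the linear inequalities \<open>b l P \<le> Q \<le> Y\<close>.\<close>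

lemma driven_exists:
  assumes \<rho>: "admissible \<rho>"
  shows "\<exists>p q. driven_by \<rho> p q"
proof -
  note \<rho>D = admissibleD[OF \<rho>]
  have "isCont (\<lambda>t. R (\<rho> t) - (1 + b)) t" for t
    by (intro continuous_intros isCont_o2[OF \<rho>D(1) R_cont])
  moreover have R_le: "R (\<rho> t) - (1 + b) \<le> 0" for t
    using R_mono[OF \<rho>D(3), of t] R_top by simp
  \<comment> \<open>Admissibility enters here: \<open>R (\<rho> t)\<close> differs from
    \<open>R \<alpha> = 1 + b\<close> by a multiple of \<open>exp (2 t)\<close>, so the exponent of
    \<open>P\<close> is integrable at \<open>-\<infinity>\<close>.\<close>
  moreover have "\<bar>R (\<rho> t) - (1 + b)\<bar> \<le> c * D0 * exp (2 * t)" for t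
  proof -
    obtain g where g: "0 \<le> g" "g \<le> c" "R \<alpha> - R (\<rho> t) = g * (\<alpha> - \<rho> t)"
      using R_diff[of \<alpha> "\<rho> t"] \<rho>D[of t] alpha0_le by auto
    have "g * (\<alpha> - \<rho> t) \<le> c * (D0 * h t)"
      using g c \<rho>D[of t] by (intro mult_mono) auto
    also have "\<dots> \<le> c * (D0 * exp (2 * t))"
      using c D0_nonneg h_bounds by (intro mult_left_mono) auto
    finally show ?thesis using g R_le[of t] R_top by simp
  qed
  ultimately obtain I1 where I1: "\<And>t. (I1 has_real_derivative R (\<rho> t) - (1 + b)) (at t)"
    and I1_lim: "(I1 \<longlongrightarrow> 0) at_bot"
    using primitive_from_minus_infinity[OF _ zero_less_numeral, of "\<lambda>t. R (\<rho> t) - (1 + b)" "c * D0"]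
    by blast
  have I1_le: "I1 t \<le> 0" for t
    using nonneg_if_nondecreasing_from_zero[of "\<lambda>t. - I1 t" "\<lambda>t. - (R (\<rho> t) - (1 + b))" t]
      tendsto_minus[OF I1_lim] DERIV_minus[OF I1] R_le by auto
  define P where "P = (\<lambda>t. \<kappa> * exp (2 * t + I1 t))"
  define S where "S = (\<lambda>t. l * P t * exp (\<rho> t))"
  have P_deriv: "(P has_real_derivative P t * (R (\<rho> t) + 1 - b)) (at t)" for t
    unfolding P_def by (rule derivative_eq_intros I1 | simp)+
  have P_pos: "0 < P t" for t using \<kappa> by (simp add: P_def)
  have P_le: "P t \<le> \<kappa> * exp (2 * t)" for t using I1_le[of t] \<kappa> by (simp add: P_def)
  have S_pos: "0 < S t" for t using P_pos[of t] l by (simp add: S_def)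
  have S_le: "S t \<le> l * \<kappa> * exp \<alpha> * exp (2 * t)" for t
  proof -
    have "S t \<le> l * (\<kappa> * exp (2 * t)) * exp \<alpha>"
      unfolding S_def using P_le[of t] l \<kappa> P_pos[of t] admissible_bounds(1)[OF \<rho>, of t] by (intro mult_mono) auto
    then show ?thesis by (simp add: mult_ac)
  qed
  have P_cont: "isCont P t" for t using P_deriv DERIV_isCont by blast
  have S_cont: "isCont S t" for t
    unfolding S_def by (intro continuous_intros P_cont \<rho>D)
  define CS where "CS = l * \<kappa> * exp \<alpha>"
  have CS: "0 < CS" using l \<kappa> by (simp add: CS_def)
  \<comment> \<open>Variation of constants for \<open>Q' = Q + b S\<close>: since \<open>S\<close>
    is of order \<open>exp (2 t)\<close>, the integrand is of order \<open>exp t\<close>, and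
    \<open>exp (- t) Q\<close> tends to 0.\<close>
  have "isCont (\<lambda>t. b * exp (- t) * S t) t" for t
    by (intro continuous_intros S_cont)
  moreover have "\<bar>b * exp (- t) * S t\<bar> \<le> b * CS * exp (1 * t)" for t
  proof -
    have "b * exp (- t) * S t \<le> b * exp (- t) * (CS * exp (2 * t))"
      using S_le[of t] b by (intro mult_left_mono) (auto simp: CS_def)
    also have "\<dots> = b * CS * exp (1 * t)"
      by (simp add: mult_ac flip: exp_add)
    finally show ?thesis using S_pos[of t] b by simp
  qed
  ultimately obtain I2 where I2: "\<And>t. (I2 has_real_derivative b * exp (- t) * S t) (at t)"
    and I2_lim: "(I2 \<longlongrightarrow> 0) at_bot" and I2_le: "\<And>t. \<bar>I2 t\<bar> \<le> b * CS / 1 * exp (1 * t)"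
    using primitive_from_minus_infinity[of "\<lambda>t. b * exp (- t) * S t" 1 "b * CS"] by auto
  have I2_nonneg: "0 \<le> I2 t" for t
    using I2_lim I2 by (rule nonneg_if_nondecreasing_from_zero) (simp add: less_imp_le S_pos b)
  define Q where "Q = (\<lambda>t. exp t * I2 t)"
  have Q_deriv: "(Q has_real_derivative Q t + b * S t) (at t)" for t
    unfolding Q_def by (rule derivative_eq_intros I2 | simp)+ (simp add: algebra_simps exp_minus)
  have Q_nonneg: "0 \<le> Q t" for t using I2_nonneg by (simp add: Q_def)
  have Q_le: "Q t \<le> b * CS * exp (2 * t)" for t
  proof -
    have "exp t * I2 t \<le> exp t * (b * CS * exp t)"
      using I2_le[of t] by (intro mult_left_mono) auto
    then show ?thesis by (simp add: Q_def mult_ac flip: exp_add)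
  qed
  have Q_cont: "isCont Q t" for t using Q_deriv DERIV_isCont by blast
  have "isCont (\<lambda>t. Q t + S t) t" for t by (intro continuous_intros S_cont Q_cont)
  moreover have "\<bar>Q t + S t\<bar> \<le> (b * CS + CS) * exp (2 * t)" for t
    using Q_nonneg[of t] Q_le[of t] S_pos[of t] S_le[of t] by (simp add: CS_def algebra_simps)
  ultimately obtain I3 where I3: "\<And>t. (I3 has_real_derivative Q t + S t) (at t)"
    and I3_lim: "(I3 \<longlongrightarrow> 0) at_bot"
    using primitive_from_minus_infinity[OF _ zero_less_numeral, of "\<lambda>t. Q t + S t" "b * CS + CS"]
    by blast
  have I3_nonneg: "0 \<le> I3 t" for t
    using I3_lim I3 by (rule nonneg_if_nondecreasing_from_zero) (simp add: less_imp_le S_pos Q_nonneg)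
  define Y where "Y = (\<lambda>t. 1 + I3 t)"
  have Y_deriv: "(Y has_real_derivative Q t + S t) (at t)" for t
    unfolding Y_def using I3 by (auto intro!: derivative_eq_intros)
  have Y1: "1 \<le> Y t" for t using I3_nonneg by (simp add: Y_def)
  then have Y0: "0 < Y t" "Y t \<noteq> 0" for t by (meson less_le_trans zero_less_one, metis not_one_le_zero)
  have Q_lim: "(Q \<longlongrightarrow> 0) at_bot"
  proof (rule tendsto_sandwich[of "\<lambda>_. 0" _ _ "\<lambda>t. b * CS * exp (2 * t)"])
    show "((\<lambda>t. b * CS * exp (2 * t)) \<longlongrightarrow> 0) at_bot"
      using tendsto_mult[OF tendsto_const exp2_tendsto_0, of "b * CS"] by simp
  qed (use Q_nonneg Q_le in auto)
  have P_lim: "(P \<longlongrightarrow> 0) at_bot"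
  proof (rule tendsto_sandwich[of "\<lambda>_. 0" _ _ "\<lambda>t. \<kappa> * exp (2 * t)"])
    show "((\<lambda>t. \<kappa> * exp (2 * t)) \<longlongrightarrow> 0) at_bot"
      using tendsto_mult[OF tendsto_const exp2_tendsto_0, of \<kappa>] by simp
  qed (simp_all add: less_imp_le P_pos P_le)
  \<comment> \<open>The derivative is \<open>(1 - b) S \<ge> 0\<close>; the outcome
    \<open>Q \<le> Y\<close> is \<open>q \<le> 1\<close>.\<close>
  have "0 \<le> I3 t - Q t" for t
  proof (rule nonneg_if_nondecreasing_from_zero[OF _ DERIV_diff[OF I3 Q_deriv]])
    show "((\<lambda>t. I3 t - Q t) \<longlongrightarrow> 0) at_bot" using tendsto_diff[OF I3_lim Q_lim] by simp
    show "0 \<le> Q t + S t - (Q t + b * S t)" for t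
      using b S_pos[of t] mult_right_mono[of b 1 "S t"] by simp
  qed
  then have QY: "Q t \<le> Y t" for t by (simp add: Y_def) (smt (verit))
  \<comment> \<open>The factor \<open>exp (- t)\<close> removes the term \<open>Q\<close> from
    \<open>Q'\<close>; what remains has the sign of
    \<open>exp \<rho> - (R \<rho> - b)\<close>.\<close>
  define W where "W = (\<lambda>t. exp (- t) * (Q t - b * l * P t))"
  have "0 \<le> W t" for t
  proof (rule nonneg_if_nondecreasing_from_zero[of W
        "\<lambda>t. exp (- t) * (b * l * P t * (exp (\<rho> t) - (R (\<rho> t) - b)))"])
    show "(W has_real_derivative exp (- t) * (b * l * P t * (exp (\<rho> t) - (R (\<rho> t) - b)))) (at t)" for t
      unfolding W_def by (rule derivative_eq_intros Q_deriv P_deriv | simp)+ (simp add: algebra_simps S_def)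
    show "0 \<le> exp (- t) * (b * l * P t * (exp (\<rho> t) - (R (\<rho> t) - b)))" for t
      using b l P_pos[of t] R_minus_b_le[OF \<rho>D(3), of t] by (intro mult_nonneg_nonneg) auto
    have "exp (- t) * Q t = I2 t" for t by (simp add: Q_def exp_minus)
    moreover have "exp (- t) * P t = \<kappa> * exp (1 * t) * exp (I1 t)" for t
    proof -
      have "exp (2 * t + I1 t) = exp t * exp t * exp (I1 t)"
        by (simp flip: exp_add)
      then show ?thesis by (simp add: P_def exp_minus)
    qed
    ultimately have "W = (\<lambda>t. I2 t - b * l * (\<kappa> * exp (1 * t) * exp (I1 t)))"
      by (auto simp: W_def right_diff_distrib)
    then show "(W \<longlongrightarrow> 0) at_bot"
      using tendsto_diff[OF I2_lim tendsto_mult[OF tendsto_const tendsto_mult[OF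
          tendsto_mult[OF tendsto_const exp_at_bot] tendsto_exp[OF I1_lim]]], of "b * l" \<kappa>]
      by simp
  qed
  then have PQ: "b * l * P t \<le> Q t" for t
    by (simp add: W_def zero_le_mult_iff)
  define p where "p = (\<lambda>t. P t / Y t)"
  define q where "q = (\<lambda>t. Q t / Y t)"
  have \<sigma>: "q t + l * p t * exp (\<rho> t) = (Q t + S t) / Y t" for t
    by (simp add: p_def q_def S_def add_divide_distrib)
  have "driven_by \<rho> p q"
    unfolding driven_by_def
  proof (intro conjI allI)
    fix t
    show "0 < p t" using P_pos Y0 by (simp add: p_def)
    have "p t \<le> P t" unfolding p_def using P_pos[of t] Y1[of t] divide_left_mono[of 1 "Y t" "P t"] Y0[of t] by simp
    then show "p t \<le> \<kappa> * exp (2 * t)" using P_le[of t] by linarith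
    show "b * l * p t \<le> q t" using divide_right_mono[OF PQ, of "Y t" t] Y0[of t] by (simp add: p_def q_def)
    show "q t \<le> 1" using QY[of t] Y0[of t] by (simp add: q_def)
    have "q t \<le> Q t" unfolding q_def using Q_nonneg[of t] Y1[of t] divide_left_mono[of 1 "Y t" "Q t"] Y0[of t] by simp
    then show "q t \<le> b * \<kappa> * l * exp \<alpha> * exp (2 * t)" using Q_le[of t] by (simp add: CS_def mult_ac)
    show "(p has_real_derivative p t * (R (\<rho> t) + 1 - b - (q t + l * p t * exp (\<rho> t)))) (at t)"
      unfolding \<sigma> unfolding p_def using Y0[of t]
      by (intro DERIV_cong[OF DERIV_divide[OF P_deriv Y_deriv]]) (auto simp: field_simps)
    have S_eq: "l * p t * exp (\<rho> t) = S t / Y t" by (simp add: p_def S_def)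
    show "(q has_real_derivative
        q t * (1 - (q t + l * p t * exp (\<rho> t))) + b * (l * p t * exp (\<rho> t))) (at t)"
      unfolding \<sigma> S_eq unfolding q_def using Y0[of t]
      by (intro DERIV_cong[OF DERIV_divide[OF Q_deriv Y_deriv]]) (auto simp: field_simps)
  next
    have "ln (p t) - 2 * t = ln \<kappa> + I1 t - ln (Y t)" for t
      using \<kappa> Y0[of t] by (simp add: p_def P_def ln_div ln_mult)
    moreover have "((\<lambda>t. ln \<kappa> + I1 t - ln (Y t)) \<longlongrightarrow> ln \<kappa>) at_bot"
      unfolding Y_def by (auto intro!: tendsto_eq_intros I1_lim I3_lim)
    ultimately show "((\<lambda>t. ln (p t) - 2 * t) \<longlongrightarrow> ln \<kappa>) at_bot" by simp
  qed
  then show ?thesis by blast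
qed

lemma drivenD:
  assumes "driven_by \<rho> p q"
  shows "0 < p t" "p t \<le> \<kappa> * exp (2 * t)" "b * l * p t \<le> q t" "q t \<le> 1"
    "q t \<le> b * \<kappa> * l * exp \<alpha> * exp (2 * t)"
    "(p has_real_derivative p t * (R (\<rho> t) + 1 - b - (q t + l * p t * exp (\<rho> t)))) (at t)"
    "(q has_real_derivative
        q t * (1 - (q t + l * p t * exp (\<rho> t))) + b * (l * p t * exp (\<rho> t))) (at t)"
    "0 < q t"
proof -
  show "0 < p t" "b * l * p t \<le> q t" "p t \<le> \<kappa> * exp (2 * t)" "q t \<le> 1"
    "q t \<le> b * \<kappa> * l * exp \<alpha> * exp (2 * t)"
    "(p has_real_derivative p t * (R (\<rho> t) + 1 - b - (q t + l * p t * exp (\<rho> t)))) (at t)"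
    "(q has_real_derivative
        q t * (1 - (q t + l * p t * exp (\<rho> t))) + b * (l * p t * exp (\<rho> t))) (at t)"
    using assms by (auto simp: driven_by_def)
  have "0 < b * l * p t" using \<open>0 < p t\<close> b l by simp
  then show "0 < q t" using \<open>b * l * p t \<le> q t\<close> by linarith
qed

lemma driven_lim:
  assumes "driven_by \<rho> p q"
  shows "((\<lambda>t. ln (p t) - 2 * t) \<longlongrightarrow> ln \<kappa>) at_bot"
  using assms by (simp add: driven_by_def)

text \<open>\<open>b l p \<le> q \<le> 1\<close> bounds \<open>l p\<close> by \<open>1 / b\<close>
  at all times, \<open>p \<le> \<kappa> exp (2 t)\<close> controls it near
  \<open>-\<infinity>\<close>, and \<open>le_2h\<close> merges the two. The form
  \<open>l p c\<close> serves where \<open>exp \<rho>\<close> is replaced by its bound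
  \<open>c\<close>.\<close>

lemma driven_bounds:
  assumes dr: "driven_by \<rho> p q" and \<rho>: "admissible \<rho>"
  shows "l * p t \<le> 1 / b" "l * p t \<le> 2 * c * h t" "l * p t * exp (\<rho> t) \<le> c2 * h t"
    "q t \<le> c2 * h t" "0 < l * p t * exp (\<rho> t)" "l * p t * c \<le> c2 * h t"
proof -
  note D = drivenD[OF dr, of t]
  show p1: "l * p t \<le> 1 / b"
    using D(3,4) b by (simp add: field_simps)
  have "l * p t \<le> c * exp (2 * t)"
  proof -
    have "l * p t \<le> l * (\<kappa> * exp (2 * t))" using D(2) l by (intro mult_left_mono) auto
    also have "\<dots> \<le> c * (1 * exp (2 * t))" using l \<kappa> c by (intro mult_mono) auto
    finally show ?thesis by simp
  qed
  then show p2: "l * p t \<le> 2 * c * h t"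
    using le_2h[of "l * p t" c t] p1 c by simp
  have "l * p t * exp (\<rho> t) \<le> l * p t * c"
    using D(1) l admissible_bounds(2)[OF \<rho>, of t] by (intro mult_left_mono) auto
  moreover show p3: "l * p t * c \<le> c2 * h t"
    using mult_right_mono[OF p2, of c] c by (simp add: power2_eq_square mult_ac)
  ultimately show "l * p t * exp (\<rho> t) \<le> c2 * h t" by linarith
  show "0 < l * p t * exp (\<rho> t)" using D(1) l by simp
  have "q t \<le> c\<^sup>2 * exp (2 * t)"
  proof -
    have "b * \<kappa> * (l * exp \<alpha>) \<le> 1 * 1 * (c * c)"
      using b \<kappa> l c by (intro mult_mono) auto
    then have "b * \<kappa> * l * exp \<alpha> * exp (2 * t) \<le> c\<^sup>2 * exp (2 * t)"
      by (intro mult_right_mono) (auto simp: power2_eq_square mult_ac)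
    then show ?thesis using D(5) by linarith
  qed
  moreover have "q t \<le> c\<^sup>2" using D(4) c one_le_power[of c 2] by linarith
  ultimately show "q t \<le> c2 * h t" using le_2h[of "q t" "c\<^sup>2" t] by simp
qed

section \<open>Lipschitz dependence of the slow variables on \<open>\<rho>\<close>\<close>

text \<open>\<open>Z / K * (\<phi> - 1)\<close> is the primitive of \<open>Z h \<phi>\<close>
  vanishing at \<open>-\<infinity>\<close>. The factor \<open>1 / K\<close> is what makes the
  feedback through the past small.\<close>

lemma log_growth_bound:
  assumes lim: "(D \<longlongrightarrow> 0) at_bot" and der: "\<And>t. (D has_real_derivative D' t) (at t)"
    and le: "\<And>t. \<bar>D' t\<bar> \<le> Z * h t * \<phi> t"
  shows "\<bar>D t\<bar> \<le> Z / K * \<phi> t"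
proof -
  have "0 \<le> Z * (h t * \<phi> t)" using le[of t] by (metis abs_ge_zero mult.assoc order_trans)
  moreover have "0 < h t * \<phi> t" using h_bounds(1)[of t] phi_ge_1[of t] by simp
  ultimately have Z: "0 \<le> Z" by (simp add: zero_le_mult_iff)
  have K0: "K \<noteq> 0" using K(1) by linarith
  define E where "E = (\<lambda>t. Z / K * (\<phi> t - 1))"
  have E: "(E has_real_derivative Z * h t * \<phi> t) (at t)" for t
    unfolding E_def
    by (intro DERIV_cong[OF DERIV_cmult[OF DERIV_diff[OF phi_deriv DERIV_const]]]) (simp add: K0)
  have E0: "(E \<longlongrightarrow> 0) at_bot"
    unfolding E_def by (auto intro!: tendsto_eq_intros phi_tendsto_1 simp: K0)
  have "0 \<le> E t + D t"
    using le by (intro nonneg_if_nondecreasing_from_zero[OF _ DERIV_add[OF E der]])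
      (use tendsto_add[OF E0 lim] in \<open>auto simp: abs_le_iff\<close>, smt (verit))
  moreover have "0 \<le> E t - D t"
    using le by (intro nonneg_if_nondecreasing_from_zero[OF _ DERIV_diff[OF E der]])
      (use tendsto_diff[OF E0 lim] in \<open>auto simp: abs_le_iff\<close>)
  moreover have "E t \<le> Z / K * \<phi> t"
    unfolding E_def using Z K by (intro mult_left_mono) auto
  ultimately show ?thesis by linarith
qed

lemma s_diff:
  assumes a1: "admissible \<rho>1" "driven_by \<rho>1 p1 q1" and a2: "admissible \<rho>2" "driven_by \<rho>2 p2 q2"
  shows "\<bar>l * p1 t * exp (\<rho>1 t) - l * p2 t * exp (\<rho>2 t)\<bar>
    \<le> c2 * h t * (\<bar>ln (p1 t) - ln (p2 t)\<bar> + \<bar>\<rho>1 t - \<rho>2 t\<bar>)"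
proof -
  have eq: "l * p t * exp (\<rho> t) = exp (ln l + ln (p t) + \<rho> t)" if "driven_by \<rho> p q" for \<rho> p q
    using l drivenD(1)[OF that] by (simp add: exp_add)
  have "\<bar>l * p1 t * exp (\<rho>1 t) - l * p2 t * exp (\<rho>2 t)\<bar>
    \<le> c2 * h t * \<bar>(ln l + ln (p1 t) + \<rho>1 t) - (ln l + ln (p2 t) + \<rho>2 t)\<bar>"
    using driven_bounds(3)[OF a1(2,1), of t] driven_bounds(3)[OF a2(2,1), of t]
    unfolding eq[OF a1(2)] eq[OF a2(2)] by (rule abs_exp_diff_le)
  also have "\<dots> \<le> c2 * h t * (\<bar>ln (p1 t) - ln (p2 t)\<bar> + \<bar>\<rho>1 t - \<rho>2 t\<bar>)"
    using h_bounds(1)[of t] by (intro mult_left_mono) auto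
  finally show ?thesis .
qed

lemma q_diff_upper:
  assumes a1: "admissible \<rho>1" "driven_by \<rho>1 p1 q1" and a2: "admissible \<rho>2" "driven_by \<rho>2 p2 q2"
    and M: "0 \<le> M" "\<And>t. \<bar>ln (p1 t) - ln (p2 t)\<bar> \<le> M * \<phi> t"
    and X: "0 \<le> X" "\<And>t. \<bar>\<rho>1 t - \<rho>2 t\<bar> \<le> X * (h t * \<phi> t)"
  shows "q1 t - q2 t \<le> c2 * (M + X / (K - 2)) * h t * \<phi> t"
proof -
  define \<beta> where "\<beta> = c2 * (M + X / (K - 2))"
  have \<beta>0: "0 \<le> \<beta>" using M X K by (simp add: \<beta>_def)
  define bar where "bar = (\<lambda>t. \<beta> * h t * \<phi> t)"
  define s1 where "s1 = (\<lambda>t. l * p1 t * exp (\<rho>1 t))"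
  define s2 where "s2 = (\<lambda>t. l * p2 t * exp (\<rho>2 t))"
  define q1' where "q1' = (\<lambda>t. q1 t * (1 - (q1 t + s1 t)) + b * s1 t)"
  define q2' where "q2' = (\<lambda>t. q2 t * (1 - (q2 t + s2 t)) + b * s2 t)"
  have q1: "(q1 has_real_derivative q1' t) (at t)" and q2: "(q2 has_real_derivative q2' t) (at t)" for t
    unfolding q1'_def q2'_def s1_def s2_def using drivenD(7)[OF a1(2)] drivenD(7)[OF a2(2)] by auto
  have bar_deriv: "(bar has_real_derivative bar t * (2 - 2 * h t + K * h t)) (at t)" for t
    unfolding bar_def
    by (rule derivative_eq_intros h_deriv phi_deriv | simp)+ (simp add: algebra_simps)
  \<comment> \<open>The factor \<open>exp (- t)\<close> cancels the linear growth of
    \<open>q\<close>, so that \<open>bar' - bar = bar (1 + (K - 2) h)\<close> is available against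
    the forcing.\<close>
  define G where "G = (\<lambda>t. exp (- t) * (bar t - (q1 t - q2 t)))"
  have "0 \<le> G t"
  proof (rule nonneg_if_nondecreasing_where_neg[of G
        "\<lambda>t. exp (- t) * (bar t * (1 + (K - 2) * h t) - (q1' t - q2' t) + (q1 t - q2 t))"])
    show "(G has_real_derivative
      exp (- t) * (bar t * (1 + (K - 2) * h t) - (q1' t - q2' t) + (q1 t - q2 t))) (at t)" for t
      unfolding G_def by (rule derivative_eq_intros bar_deriv q1 q2 | simp)+ (simp add: algebra_simps)
    have lim: "((\<lambda>t. exp (- t) * q t) \<longlongrightarrow> 0) at_bot" if "driven_by \<rho> p q" for \<rho> p q
    proof (rule tendsto_sandwich[of "\<lambda>_. 0" _ _ "\<lambda>t. b * \<kappa> * l * exp \<alpha> * exp t"])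
      show "((\<lambda>t. b * \<kappa> * l * exp \<alpha> * exp t) \<longlongrightarrow> 0) at_bot"
        using tendsto_mult[OF tendsto_const exp_at_bot] by simp
      have "exp (- t) * q t \<le> exp (- t) * (b * \<kappa> * l * exp \<alpha> * exp (2 * t))" for t
        using drivenD(5)[OF that] by (intro mult_left_mono) auto
      also have "exp (- t) * (b * \<kappa> * l * exp \<alpha> * exp (2 * t)) = b * \<kappa> * l * exp \<alpha> * exp t" for t
        by (simp add: mult_ac flip: exp_add)
      finally show "eventually (\<lambda>t. exp (- t) * q t \<le> b * \<kappa> * l * exp \<alpha> * exp t) at_bot" by simp
      show "eventually (\<lambda>t. 0 \<le> exp (- t) * q t) at_bot"
        by (simp add: less_imp_le[OF drivenD(8)[OF that]])
    qed simp
    have eh: "exp (- t) * h t = exp t / (1 + exp (2 * t))" for t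
      by (simp add: h_def flip: exp_add)
    have "exp (- t) * bar t = \<beta> * (exp (- t) * h t) * \<phi> t" for t
      by (simp add: bar_def)
    then have bar_eq: "(\<lambda>t. exp (- t) * bar t) = (\<lambda>t. \<beta> * (exp t / (1 + exp (2 * t))) * \<phi> t)"
      by (simp only: eh)
    have "((\<lambda>t :: real. exp t / (1 + exp (2 * t))) \<longlongrightarrow> 0 / (1 + 0)) at_bot"
      by (intro tendsto_divide tendsto_add exp_at_bot exp2_tendsto_0 tendsto_const) simp
    then have "((\<lambda>t. \<beta> * (exp t / (1 + exp (2 * t))) * \<phi> t) \<longlongrightarrow> \<beta> * (0 / (1 + 0)) * 1) at_bot"
      by (intro tendsto_mult phi_tendsto_1 tendsto_const)
    then have "((\<lambda>t. \<beta> * (exp t / (1 + exp (2 * t))) * \<phi> t) \<longlongrightarrow> 0) at_bot"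
      by simp
    then have "((\<lambda>t. exp (- t) * bar t) \<longlongrightarrow> 0) at_bot" by (simp only: bar_eq)
    from tendsto_diff[OF this tendsto_diff[OF lim[OF a1(2)] lim[OF a2(2)]]]
    show "(G \<longlongrightarrow> 0) at_bot" unfolding G_def by (simp add: algebra_simps)
  next
    fix t assume "G t < 0"
    then have e: "bar t < q1 t - q2 t" by (simp add: G_def mult_less_0_iff)
    have bar0: "0 \<le> bar t" using \<beta>0 h_bounds(1)[of t] phi_ge_1[of t] by (simp add: bar_def)
    have bnd: "0 < s1 t" "0 < q1 t" "q2 t \<le> 1" "0 < q2 t"
      using driven_bounds(5)[OF a1(2,1)] drivenD(8)[OF a1(2)] drivenD(4,8)[OF a2(2)] by (auto simp: s1_def)
    have "q1' t - q2' t = (q1 t - q2 t) * (1 - q1 t - q2 t - s1 t) + (b - q2 t) * (s1 t - s2 t)"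
      by (simp add: q1'_def q2'_def algebra_simps)
    also have "\<dots> \<le> (q1 t - q2 t) * 1 + \<bar>s1 t - s2 t\<bar>"
    proof (rule add_mono)
      show "(q1 t - q2 t) * (1 - q1 t - q2 t - s1 t) \<le> (q1 t - q2 t) * 1"
        using e bar0 bnd by (intro mult_left_mono) auto
      have "\<bar>b - q2 t\<bar> * \<bar>s1 t - s2 t\<bar> \<le> 1 * \<bar>s1 t - s2 t\<bar>"
        using b bnd by (intro mult_right_mono) (auto simp: abs_le_iff)
      then show "(b - q2 t) * (s1 t - s2 t) \<le> \<bar>s1 t - s2 t\<bar>"
        by (metis abs_ge_self abs_mult mult_1 order_trans)
    qed
    finally have "q1' t - q2' t \<le> (q1 t - q2 t) + \<bar>s1 t - s2 t\<bar>" by simp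
    moreover have "\<bar>s1 t - s2 t\<bar> \<le> bar t * (1 + (K - 2) * h t)"
    proof -
      have "\<bar>s1 t - s2 t\<bar> \<le> c2 * h t * (\<bar>ln (p1 t) - ln (p2 t)\<bar> + \<bar>\<rho>1 t - \<rho>2 t\<bar>)"
        unfolding s1_def s2_def by (rule s_diff[OF a1 a2])
      also have "\<dots> \<le> c2 * h t * (M * \<phi> t + X * (h t * \<phi> t))"
        using h_bounds(1)[of t] M(2)[of t] X(2)[of t] by (intro mult_left_mono add_mono) auto
      \<comment> \<open>This dictates \<open>\<beta>\<close>: the 1 in \<open>1 + (K - 2) h\<close>
        absorbs the \<open>M\<close> term, and \<open>(K - 2) h\<close> absorbs the \<open>X\<close>
        term, which carries an additional factor \<open>h\<close>.\<close>
      also have "\<dots> = (c2 * (h t * \<phi> t)) * (M + X / (K - 2) * ((K - 2) * h t))"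
      proof -
        have eq: "X / (K - 2) * ((K - 2) * h t) = X * h t" using K(1) by simp
        show ?thesis unfolding eq by (simp add: distrib_left mult_ac)
      qed
      also have "\<dots> \<le> (c2 * (h t * \<phi> t)) * ((M + X / (K - 2)) * (1 + (K - 2) * h t))"
      proof (rule mult_left_mono)
        have "0 \<le> M * ((K - 2) * h t)" "0 \<le> X / (K - 2)" using M(1) X(1) K h_bounds(1)[of t] by auto
        then show "M + X / (K - 2) * ((K - 2) * h t) \<le> (M + X / (K - 2)) * (1 + (K - 2) * h t)"
          by (simp add: distrib_left distrib_right)
        show "0 \<le> c2 * (h t * \<phi> t)" using h_bounds(1)[of t] phi_ge_1[of t] by simp
      qed
      also have "\<dots> = bar t * (1 + (K - 2) * h t)"
        by (simp only: bar_def \<beta>_def mult_ac)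
      finally show ?thesis .
    qed
    ultimately show "0 \<le> exp (- t) * (bar t * (1 + (K - 2) * h t) - (q1' t - q2' t) + (q1 t - q2 t))"
      by (intro mult_nonneg_nonneg) auto
  qed
  then show ?thesis by (simp add: G_def zero_le_mult_iff bar_def \<beta>_def)
qed

lemma q_diff:
  assumes a1: "admissible \<rho>1" "driven_by \<rho>1 p1 q1" and a2: "admissible \<rho>2" "driven_by \<rho>2 p2 q2"
    and M: "0 \<le> M" "\<And>t. \<bar>ln (p1 t) - ln (p2 t)\<bar> \<le> M * \<phi> t"
    and X: "0 \<le> X" "\<And>t. \<bar>\<rho>1 t - \<rho>2 t\<bar> \<le> X * (h t * \<phi> t)"
  shows "\<bar>q1 t - q2 t\<bar> \<le> c2 * (M + X / (K - 2)) * h t * \<phi> t"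
proof -
  have "q1 t - q2 t \<le> c2 * (M + X / (K - 2)) * h t * \<phi> t"
    by (rule q_diff_upper[OF a1 a2 M X])
  moreover have "q2 t - q1 t \<le> c2 * (M + X / (K - 2)) * h t * \<phi> t"
    by (rule q_diff_upper[OF a2 a1 M(1) _ X(1)]) (use M(2) X(2) in \<open>simp_all add: abs_minus_commute\<close>)
  ultimately show ?thesis by linarith
qed

lemma c_bounds: "1 \<le> c2" "c \<le> c2" "1 \<le> c\<^sup>2"
proof -
  show "1 \<le> c\<^sup>2" using c one_le_power by blast
  moreover have "c * 1 \<le> c * c" using c by (intro mult_left_mono) auto
  ultimately show "1 \<le> c2" "c \<le> c2" by (auto simp: power2_eq_square)
qed

text \<open>A bootstrap: a bound \<open>M \<phi>\<close> on the difference \<open>D\<close> of the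
  logarithms bounds the differences of \<open>q\<close> and \<open>s\<close>, hence
  \<open>D'\<close>, by a multiple of \<open>(M + X) h \<phi>\<close>. Integration divides by
  \<open>K\<close>, and \<open>8 c\<^sup>2 \<le> K\<close> returns \<open>M\<close> at most halved,
  as \<open>self_improving_bound\<close> requires.\<close>

lemma driven_lipschitz:
  assumes a1: "admissible \<rho>1" "driven_by \<rho>1 p1 q1" and a2: "admissible \<rho>2" "driven_by \<rho>2 p2 q2"
    and X: "0 \<le> X" "\<And>t. \<bar>\<rho>1 t - \<rho>2 t\<bar> \<le> X * (h t * \<phi> t)"
  shows "\<bar>ln (p1 t) - ln (p2 t)\<bar> \<le> 6 * c2 * X / K * \<phi> t"
    and "\<bar>q1 t - q2 t\<bar> \<le> 8 * c2\<^sup>2 * X / K * (h t * \<phi> t)"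
proof -
  define D where "D = (\<lambda>t. ln (p1 t) - ln (p2 t))"
  define s1 where "s1 = (\<lambda>t. l * p1 t * exp (\<rho>1 t))"
  define s2 where "s2 = (\<lambda>t. l * p2 t * exp (\<rho>2 t))"
  define D' where "D' = (\<lambda>t. (R (\<rho>1 t) - R (\<rho>2 t)) - (q1 t - q2 t) - (s1 t - s2 t))"
  have D: "(D has_real_derivative D' t) (at t)" for t
    unfolding D_def D'_def s1_def s2_def
    using drivenD(1)[OF a1(2), of t] drivenD(1)[OF a2(2), of t]
    by (auto intro!: derivative_eq_intros drivenD(6)[OF a1(2)] drivenD(6)[OF a2(2)])
  have D0: "(D \<longlongrightarrow> 0) at_bot"
    using tendsto_diff[OF driven_lim[OF a1(2)] driven_lim[OF a2(2)]] by (simp add: D_def)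
  have Rd: "\<bar>R (\<rho>1 t) - R (\<rho>2 t)\<bar> \<le> c * X * h t * \<phi> t" for t
  proof -
    obtain g where g: "0 \<le> g" "g \<le> c" "R (\<rho>1 t) - R (\<rho>2 t) = g * (\<rho>1 t - \<rho>2 t)"
      using R_diff[of "\<rho>1 t" "\<rho>2 t"] admissibleD[OF a1(1), of t] admissibleD[OF a2(1), of t] by metis
    have "g * \<bar>\<rho>1 t - \<rho>2 t\<bar> \<le> c * (X * (h t * \<phi> t))"
      using g X c by (intro mult_mono) auto
    then show ?thesis using g by (simp add: abs_mult mult_ac)
  qed
  have D_bound: "\<bar>D t\<bar> \<le> Z / K * \<phi> t"
    if "\<And>t. \<bar>q1 t - q2 t\<bar> + \<bar>s1 t - s2 t\<bar> \<le> (Z - c * X) * h t * \<phi> t" for Z t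
  proof (rule log_growth_bound[OF D0 D])
    fix t
    have "\<bar>D' t\<bar> \<le> \<bar>R (\<rho>1 t) - R (\<rho>2 t)\<bar> + (\<bar>q1 t - q2 t\<bar> + \<bar>s1 t - s2 t\<bar>)"
      unfolding D'_def by linarith
    also have "\<dots> \<le> c * X * h t * \<phi> t + (Z - c * X) * h t * \<phi> t"
      by (intro add_mono Rd that)
    finally show "\<bar>D' t\<bar> \<le> Z * h t * \<phi> t" by (simp add: algebra_simps)
  qed
  have hphi: "0 \<le> h t * \<phi> t" for t using h_bounds(1)[of t] phi_ge_1[of t] by simp
  have main: "\<bar>D t\<bar> \<le> 2 * ((c + 2 * c2) * X / K) * \<phi> t" for t
  proof (rule self_improving_bound[of \<phi> D "(2 * c2 + c * X) / K"])
    show "0 < \<phi> t" for t using phi_ge_1[of t] by simp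
    \<comment> \<open>A first finite bound, from the size of \<open>q\<close> and \<open>s\<close>
      alone.\<close>
    show "\<bar>D t\<bar> \<le> ((2 * c2 + c * X) / K) * \<phi> t" for t
    proof (rule D_bound)
      fix t
      have "\<bar>q1 t - q2 t\<bar> \<le> c2 * h t"
        using drivenD(8)[OF a1(2), of t] drivenD(8)[OF a2(2), of t] driven_bounds(4)[OF a1(2,1), of t]
          driven_bounds(4)[OF a2(2,1), of t] by linarith
      moreover have "\<bar>s1 t - s2 t\<bar> \<le> c2 * h t"
        using driven_bounds(3,5)[OF a1(2,1), of t]
          driven_bounds(3,5)[OF a2(2,1), of t] unfolding s1_def s2_def by linarith
      ultimately have "\<bar>q1 t - q2 t\<bar> + \<bar>s1 t - s2 t\<bar> \<le> 2 * c2 * h t * 1" by simp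
      also have "\<dots> \<le> 2 * c2 * h t * \<phi> t"
        using h_bounds(1)[of t] phi_ge_1[of t] by (intro mult_left_mono) auto
      finally show "\<bar>q1 t - q2 t\<bar> + \<bar>s1 t - s2 t\<bar> \<le> (2 * c2 + c * X - c * X) * h t * \<phi> t" by simp
    qed
    fix M t assume M: "0 \<le> M" "\<And>t. \<bar>D t\<bar> \<le> M * \<phi> t"
    have "\<bar>D t\<bar> \<le> ((2 * c2 * M + (c + 2 * c2) * X) / K) * \<phi> t"
    proof (rule D_bound)
      fix t
      have "\<bar>q1 t - q2 t\<bar> \<le> c2 * (M + X / (K - 2)) * h t * \<phi> t"
        by (rule q_diff[OF a1 a2 M(1) _ X]) (use M(2) in \<open>simp add: D_def\<close>)
      also have "\<dots> \<le> c2 * (M + X) * h t * \<phi> t"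
      proof -
        have "X / (K - 2) \<le> X / 1" using K X(1) by (intro divide_left_mono) auto
        then have "c2 * (M + X / (K - 2)) * (h t * \<phi> t) \<le> c2 * (M + X) * (h t * \<phi> t)"
          by (intro mult_right_mono mult_left_mono hphi) auto
        then show ?thesis by (simp only: mult.assoc)
      qed
      finally have q: "\<bar>q1 t - q2 t\<bar> \<le> c2 * (M + X) * h t * \<phi> t" .
      have "\<bar>s1 t - s2 t\<bar> \<le> c2 * h t * (\<bar>D t\<bar> + \<bar>\<rho>1 t - \<rho>2 t\<bar>)"
        unfolding s1_def s2_def D_def by (rule s_diff[OF a1 a2])
      also have "\<dots> \<le> c2 * h t * (M * \<phi> t + X * (1 * \<phi> t))"
      proof (intro mult_left_mono add_mono M(2))
        have "X * (h t * \<phi> t) \<le> X * (1 * \<phi> t)"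
          using X(1) h_bounds(2)[of t] phi_ge_1[of t] by (intro mult_left_mono mult_right_mono) auto
        then show "\<bar>\<rho>1 t - \<rho>2 t\<bar> \<le> X * (1 * \<phi> t)" using X(2)[of t] by linarith
      qed (use h_bounds(1)[of t] in auto)
      also have "\<dots> = c2 * (M + X) * h t * \<phi> t" by (simp add: algebra_simps)
      finally have "\<bar>s1 t - s2 t\<bar> \<le> c2 * (M + X) * h t * \<phi> t" .
      with q show "\<bar>q1 t - q2 t\<bar> + \<bar>s1 t - s2 t\<bar> \<le> (2 * c2 * M + (c + 2 * c2) * X - c * X) * h t * \<phi> t"
        by (simp add: algebra_simps)
    qed
    also have "\<dots> \<le> (M / 2 + (c + 2 * c2) * X / K) * \<phi> t"
    proof (rule mult_right_mono)
      have "2 * c2 * M \<le> K / 2 * M" using K(2) M(1) by (intro mult_right_mono) auto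
      then show "(2 * c2 * M + (c + 2 * c2) * X) / K \<le> M / 2 + (c + 2 * c2) * X / K"
        using K(1) by (simp add: field_simps)
      show "0 \<le> \<phi> t" using phi_ge_1[of t] by simp
    qed
    finally show "\<bar>D t\<bar> \<le> (M / 2 + (c + 2 * c2) * X / K) * \<phi> t" .
  qed
  have Dfin: "\<bar>D t\<bar> \<le> 6 * c2 * X / K * \<phi> t" for t
  proof -
    have "2 * ((c + 2 * c2) * X / K) \<le> 6 * c2 * X / K"
    proof -
      have "2 * (c + 2 * c2) * X \<le> 6 * c2 * X"
        using c_bounds X(1) by (intro mult_right_mono) auto
      then have "2 * (c + 2 * c2) * X / K \<le> 6 * c2 * X / K"
        using K(1) by (intro divide_right_mono) auto
      then show ?thesis by (simp only: mult.assoc times_divide_eq_right)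
    qed
    then have "2 * ((c + 2 * c2) * X / K) * \<phi> t \<le> 6 * c2 * X / K * \<phi> t"
      using phi_ge_1[of t] by (intro mult_right_mono) auto
    then show ?thesis using main[of t] by linarith
  qed
  then show "\<bar>ln (p1 t) - ln (p2 t)\<bar> \<le> 6 * c2 * X / K * \<phi> t" by (simp add: D_def)
  have "\<bar>q1 t - q2 t\<bar> \<le> c2 * (6 * c2 * X / K + X / (K - 2)) * h t * \<phi> t"
    using Dfin X K c_bounds by (intro q_diff[OF a1 a2]) (auto simp: D_def)
  also have "\<dots> = c2 * (6 * c2 * X / K + X / (K - 2)) * (h t * \<phi> t)" by simp
  also have "\<dots> \<le> 8 * c2\<^sup>2 * X / K * (h t * \<phi> t)"
  proof (intro mult_right_mono hphi)
    have "X / (K - 2) \<le> X / (K / 2)" using K X(1) by (intro divide_left_mono) auto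
    also have "\<dots> = 2 * 1 * X / K" by simp
    also have "\<dots> \<le> 2 * c2 * X / K" using c_bounds X(1) K by (intro divide_right_mono mult_right_mono) auto
    finally have "6 * c2 * X / K + X / (K - 2) \<le> 6 * c2 * X / K + 2 * c2 * X / K"
      by (rule add_left_mono)
    also have "\<dots> = 8 * c2 * X / K" by (simp add: field_simps)
    finally have "c2 * (6 * c2 * X / K + X / (K - 2)) \<le> c2 * (8 * c2 * X / K)"
      using c_bounds by (intro mult_left_mono) auto
    then show "c2 * (6 * c2 * X / K + X / (K - 2)) \<le> 8 * c2\<^sup>2 * X / K"
      by (simp add: power2_eq_square mult_ac)
  qed
  finally show "\<bar>q1 t - q2 t\<bar> \<le> 8 * c2\<^sup>2 * X / K * (h t * \<phi> t)" .
qed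

subsection \<open>The fixed point\<close>

text \<open>Bounds the slope of \<open>F\<close> in \<open>\<rho>\<close>: \<open>c\<^sup>2\<close>
  from \<open>l p exp \<rho>\<close> and \<open>c\<close> from \<open>d R\<close>.\<close>

abbreviation "K1 \<equiv> c\<^sup>2 + c"

definition drive :: "(real \<Rightarrow> real) \<Rightarrow> (real \<Rightarrow> real) \<Rightarrow> (real \<Rightarrow> real) \<Rightarrow> real \<Rightarrow> real" where
  "drive p q \<rho> t = \<rho> t - F (p t) (q t) (\<rho> t) / K1"

lemma K1_pos: "0 < K1"
  using c c_bounds(3) by linarith

section \<open>Barriers for the relaxed fast equation\<close>

lemma exp_diff_slope:
  assumes "x \<le> \<alpha>" "y \<le> \<alpha>"
  obtains g where "0 \<le> g" "g \<le> c" "exp x - exp y = g * (x - y)"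
proof -
  have *: "exp z \<le> c" if "z \<le> \<alpha>" for z
    using that c(2) exp_le_cancel_iff[of z \<alpha>] by linarith
  consider "x < y" | "y < x" | "x = y" by linarith
  then show ?thesis
  proof cases
    case 1
    obtain z where z: "x < z" "z < y" "exp y - exp x = (y - x) * exp z"
      using MVT2[OF 1 DERIV_exp] by blast
    then have "exp x - exp y = exp z * (x - y)" by (simp add: algebra_simps)
    then show ?thesis using *[of z] assms z by (intro that[of "exp z"]) auto
  next
    case 2
    obtain z where z: "y < z" "z < x" "exp x - exp y = (x - y) * exp z"
      using MVT2[OF 2 DERIV_exp] by blast
    then show ?thesis using *[of z] assms by (intro that[of "exp z"]) auto
  next
    case 3
    then show ?thesis using *[of x] assms by (intro that[of "exp x"]) auto
  qed
qed

lemma F_diff: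
  assumes p: "0 \<le> p" "l * p \<le> c"
    and xy: "\<alpha>0 \<le> x" "x \<le> \<alpha>" "\<alpha>0 \<le> y" "y \<le> \<alpha>"
  obtains g where "k0 \<le> g" "g \<le> K1" "F p q x - F p q y = g * (x - y)"
proof -
  obtain g1 where g1: "0 \<le> g1" "g1 \<le> c" "exp x - exp y = g1 * (x - y)"
    using exp_diff_slope xy by metis
  obtain g2 where g2: "k0 \<le> d * g2" "0 \<le> g2" "g2 \<le> c" "R x - R y = g2 * (x - y)"
    using R_diff xy by metis
  have "l * p * g1 \<le> c * c" using p l g1 c by (intro mult_mono) auto
  moreover have "0 \<le> l * p * g1" using p l g1 by simp
  moreover have "d * g2 \<le> 1 * c" using d g2 c by (intro mult_mono) auto
  moreover have "F p q x - F p q y = l * p * (exp x - exp y) + d * (R x - R y)"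
    by (simp add: F_def algebra_simps)
  then have "F p q x - F p q y = (l * p * g1 + d * g2) * (x - y)"
    unfolding g1 g2 by (simp add: algebra_simps)
  ultimately show ?thesis
    using g2(1) by (intro that[of "l * p * g1 + d * g2"]) (auto simp: power2_eq_square)
qed

lemma driven_p_le:
  assumes dr: "driven_by \<rho> p q" and \<rho>: "admissible \<rho>"
  shows "0 \<le> p t" "l * p t \<le> c"
  using drivenD(1)[OF dr, of t] driven_bounds(1)[OF dr \<rho>, of t] c by linarith+

text \<open>\<open>q \<le> 1\<close>, \<open>l p \<le> 1 / b\<close> and \<open>bottom\<close> give
  \<open>F \<le> 0\<close> at \<open>\<alpha>0\<close>. Measuring \<open>d R\<close> from its value
  \<open>1 - b\<close> at \<open>\<alpha>\<close> gives
  \<open>F \<ge> - K1 (\<alpha> - \<rho>)\<close>. With the slope bound \<open>K1\<close> both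
  levels are preserved. The third bound sets the slope lower bound \<open>k0\<close> against the
  forcing \<open>q + s \<le> 2 c2 h\<close>.\<close>

lemma drive_bounds:
  assumes dr: "driven_by \<rho> p q" and \<rho>: "admissible \<rho>"
  shows "\<alpha>0 \<le> drive p q \<rho> t" "drive p q \<rho> t \<le> \<alpha>"
    "\<alpha> - h t * ((1 - k0 / K1) * D0 + 2 * c2 / K1) \<le> drive p q \<rho> t"
proof -
  note \<rho>D = admissibleD[OF \<rho>, of t] and D = drivenD[OF dr, of t]
  note Kp = K1_pos
  note \<alpha> = alpha0_le
  have "l * p t * exp \<alpha>0 \<le> 1 / b * exp \<alpha>0"
    using driven_bounds(1)[OF dr \<rho>] by (intro mult_right_mono) auto
  then have F0: "F (p t) (q t) \<alpha>0 \<le> 0"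
    using bottom D(4) by (simp add: F_def R_def)
  obtain g where g: "k0 \<le> g" "g \<le> K1" "F (p t) (q t) (\<rho> t) - F (p t) (q t) \<alpha>0 = g * (\<rho> t - \<alpha>0)"
    using F_diff[OF driven_p_le[OF dr \<rho>, of t] \<rho>D(2,3), of \<alpha>0] \<alpha> by blast
  have "g * (\<rho> t - \<alpha>0) \<le> K1 * (\<rho> t - \<alpha>0)" using g \<rho>D by (intro mult_right_mono) auto
  then have "F (p t) (q t) (\<rho> t) \<le> K1 * (\<rho> t - \<alpha>0)" using F0 g by linarith
  then have "F (p t) (q t) (\<rho> t) / K1 \<le> \<rho> t - \<alpha>0" using Kp by (simp add: pos_divide_le_eq mult.commute)
  then show "\<alpha>0 \<le> drive p q \<rho> t" by (simp add: drive_def)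
  define s where "s = l * p t * exp (\<rho> t)"
  have s: "0 < s" "s \<le> c2 * h t" using driven_bounds(3,5)[OF dr \<rho>, of t] by (auto simp: s_def)
  obtain g where g: "k0 \<le> d * g" "0 \<le> g" "g \<le> c" "R \<alpha> - R (\<rho> t) = g * (\<alpha> - \<rho> t)"
    using R_diff[of \<alpha> "\<rho> t"] \<rho>D \<alpha> by auto
  have dg: "d * g \<le> K1"
  proof -
    have "d * g \<le> 1 * c" using d g c by (intro mult_mono) auto
    then show ?thesis using zero_le_power2[of c] by linarith
  qed
  have "R (\<rho> t) = (1 + b) - g * (\<alpha> - \<rho> t)" using g(4) R_top by linarith
  then have dR: "d * R (\<rho> t) = (1 - b) - d * g * (\<alpha> - \<rho> t)"
    using db by (simp add: right_diff_distrib)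
  have Feq: "F (p t) (q t) (\<rho> t) = q t + s - d * g * (\<alpha> - \<rho> t)"
    by (simp add: F_def s_def dR)
  have "d * g * (\<alpha> - \<rho> t) \<le> K1 * (\<alpha> - \<rho> t)" using dg \<rho>D by (intro mult_right_mono) auto
  then have "- (K1 * (\<alpha> - \<rho> t)) \<le> F (p t) (q t) (\<rho> t)"
    using Feq s(1) D(8) by linarith
  moreover have "- (\<alpha> - \<rho> t) * K1 = - (K1 * (\<alpha> - \<rho> t))" by (simp only: minus_mult_left mult.commute)
  ultimately have "- (\<alpha> - \<rho> t) * K1 \<le> F (p t) (q t) (\<rho> t)" by (simp only:)
  then have "- (\<alpha> - \<rho> t) \<le> F (p t) (q t) (\<rho> t) / K1" by (simp only: pos_le_divide_eq[OF Kp])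
  then show "drive p q \<rho> t \<le> \<alpha>" by (simp add: drive_def)
  have "k0 * (\<alpha> - \<rho> t) \<le> d * g * (\<alpha> - \<rho> t)" using g \<rho>D by (intro mult_right_mono) auto
  then have "F (p t) (q t) (\<rho> t) \<le> 2 * c2 * h t - k0 * (\<alpha> - \<rho> t)"
    using Feq s(2) driven_bounds(4)[OF dr \<rho>, of t] by linarith
  then have "F (p t) (q t) (\<rho> t) / K1 \<le> (2 * c2 * h t - k0 * (\<alpha> - \<rho> t)) / K1"
    using Kp by (intro divide_right_mono) auto
  then have "\<alpha> - drive p q \<rho> t \<le> (\<alpha> - \<rho> t) + (2 * c2 * h t - k0 * (\<alpha> - \<rho> t)) / K1"
    unfolding drive_def by linarith
  also have "\<dots> = (1 - k0 / K1) * (\<alpha> - \<rho> t) + 2 * c2 / K1 * h t"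
    by (simp add: diff_divide_distrib left_diff_distrib)
  also have "\<dots> \<le> (1 - k0 / K1) * (D0 * h t) + 2 * c2 / K1 * h t"
  proof (intro add_right_mono mult_left_mono \<rho>D(4))
    have "k0 \<le> K1" using g(1) dg by linarith
    then show "0 \<le> 1 - k0 / K1" using Kp by simp
  qed
  also have "\<dots> = h t * ((1 - k0 / K1) * D0 + 2 * c2 / K1)"
    by (simp only: distrib_left mult_ac)
  finally show "\<alpha> - h t * ((1 - k0 / K1) * D0 + 2 * c2 / K1) \<le> drive p q \<rho> t" by linarith
qed

lemma k0_le_K1: "k0 \<le> K1"
proof -
  have "exp (m * \<alpha>0) / l \<le> exp (m * \<alpha>) / l"
    using alpha0_le m l by (intro divide_right_mono) auto
  then have "d * (exp (m * \<alpha>0) / l) \<le> 1 * c"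
    using d c l by (intro mult_mono) auto
  then show ?thesis using k0 zero_le_power2[of c] by linarith
qed

lemma drive_cont:
  assumes dr: "driven_by \<rho> p q" and \<rho>: "admissible \<rho>"
  shows "isCont (drive p q \<rho>) t"
proof -
  have "isCont p t" "isCont q t"
    using drivenD(6,7)[OF dr, of t] DERIV_isCont by blast+
  moreover have "isCont (\<lambda>t. R (\<rho> t)) t" by (rule isCont_o2[OF admissibleD(1)[OF \<rho>] R_cont])
  ultimately show ?thesis
    unfolding drive_def F_def using admissibleD(1)[OF \<rho>, of t] K1_pos
    by (intro continuous_intros) auto
qed

text \<open>A fixed point \<open>u = \<rho>\<close> solves \<open>n \<rho>' = F\<close>. The map \<open>\<rho> \<mapsto> \<rho> - F / K1\<close> is increasing with slope at most
  \<open>1 - k0 / K1\<close>, which gives both the invariance of the barriers and the contraction.\<close>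

definition relaxed :: "(real \<Rightarrow> real) \<Rightarrow> (real \<Rightarrow> real) \<Rightarrow> (real \<Rightarrow> real) \<Rightarrow> (real \<Rightarrow> real) \<Rightarrow> bool" where
  "relaxed \<rho> p q u \<longleftrightarrow> driven_by \<rho> p q \<and> admissible u \<and>
     (\<forall>t. (u has_real_derivative K1 / n * (u t - drive p q \<rho> t)) (at t))"

lemma bounded_mult_exp_tendsto_0:
  fixes f :: "real \<Rightarrow> real"
  assumes "0 < k" "\<And>t. \<bar>f t\<bar> \<le> C"
  shows "((\<lambda>t. exp (- (k * t)) * f t) \<longlongrightarrow> 0) at_top"
proof (rule Lim_null_comparison)
  show "eventually (\<lambda>t. norm (exp (- (k * t)) * f t) \<le> C * exp (- (k * t))) at_top"
    using assms(2) by (auto simp: abs_mult mult.commute intro!: always_eventually mult_right_mono)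
  show "((\<lambda>t. C * exp (- (k * t))) \<longlongrightarrow> 0) at_top"
    using tendsto_mult[OF tendsto_const exp_linear_tendsto_0_at_top[OF assms(1)], of C] by simp
qed

text \<open>The backward equation discounts the future at rate \<open>K1 / n\<close>; this has to
  exceed the growth rate \<open>K\<close> of the weight.\<close>

lemma k_large: "0 < K1 / n" "K < K1 / n"
proof -
  show "0 < K1 / n" using K1_pos n by simp
  have "K * n < K1" using K(4) k0(1) k0_le_K1 by linarith
  then show "K < K1 / n" using n by (simp add: pos_less_divide_eq)
qed

lemma relaxed_exists:
  assumes \<rho>: "admissible \<rho>"
  shows "\<exists>p q u. relaxed \<rho> p q u"
proof -
  obtain p q where dr: "driven_by \<rho> p q" using driven_exists[OF \<rho>] by blast
  note kp = k_large
  note db = drive_bounds[OF dr \<rho>]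
  have "\<bar>drive p q \<rho> t\<bar> \<le> \<bar>\<alpha>0\<bar> + \<bar>\<alpha>\<bar>" for t
    using db(1,2)[of t] by linarith
  then obtain u where u: "\<And>t. (u has_real_derivative K1 / n * (u t - drive p q \<rho> t)) (at t)"
    and ub: "\<And>t. \<bar>u t\<bar> \<le> \<bar>\<alpha>0\<bar> + \<bar>\<alpha>\<bar>"
    using bounded_backward_solution[OF drive_cont[OF dr \<rho>] kp(1)] by blast
  have "u t \<le> \<alpha>" for t
  proof (rule backward_comparison[OF u])
    show "((\<lambda>_. \<alpha>) has_real_derivative 0) (at s)" for s by simp
    have "\<bar>\<alpha> - u s\<bar> \<le> 2 * \<bar>\<alpha>\<bar> + \<bar>\<alpha>0\<bar>" for s using ub[of s] by linarith
    then show "((\<lambda>t. exp (- (K1 / n * t)) * (\<alpha> - u t)) \<longlongrightarrow> 0) at_top"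
      by (rule bounded_mult_exp_tendsto_0[OF kp(1)])
    show "0 - K1 / n * \<alpha> \<le> K1 / n * (u s - drive p q \<rho> s) - K1 / n * u s" for s
      using mult_left_mono[OF db(2), of "K1 / n" s] kp(1) by (simp only: right_diff_distrib) linarith
  qed
  moreover have "\<alpha>0 \<le> u t" for t
  proof (rule backward_comparison[OF _ u])
    show "((\<lambda>_. \<alpha>0) has_real_derivative 0) (at s)" for s by simp
    have "\<bar>u s - \<alpha>0\<bar> \<le> \<bar>\<alpha>\<bar> + 2 * \<bar>\<alpha>0\<bar>" for s using ub[of s] by linarith
    then show "((\<lambda>t. exp (- (K1 / n * t)) * (u t - \<alpha>0)) \<longlongrightarrow> 0) at_top"
      by (rule bounded_mult_exp_tendsto_0[OF kp(1)])
    show "K1 / n * (u s - drive p q \<rho> s) - K1 / n * u s \<le> 0 - K1 / n * \<alpha>0" for s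
      using mult_left_mono[OF db(1), of "K1 / n" s] kp(1) by (simp only: right_diff_distrib) linarith
  qed
  moreover have "\<alpha> - D0 * h t \<le> u t" for t
  proof (rule backward_comparison[OF _ u])
    show "((\<lambda>t. \<alpha> - D0 * h t) has_real_derivative - (D0 * (2 * h s * (1 - h s)))) (at s)" for s
      by (rule derivative_eq_intros h_deriv | simp)+
    have "\<bar>u s - (\<alpha> - D0 * h s)\<bar> \<le> 2 * \<bar>\<alpha>\<bar> + \<bar>\<alpha>0\<bar> + D0" for s
    proof -
      have "0 \<le> D0 * h s" "D0 * h s \<le> D0 * 1"
        using mult_nonneg_nonneg[OF D0_nonneg, of "h s"] mult_left_mono[OF _ D0_nonneg, of "h s" 1]
          h_bounds(1,2)[of s] by (simp_all only: less_imp_le)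
      then show ?thesis using ub[of s] by linarith
    qed
    then show "((\<lambda>t. exp (- (K1 / n * t)) * (u t - (\<alpha> - D0 * h t))) \<longlongrightarrow> 0) at_top"
      by (rule bounded_mult_exp_tendsto_0[OF kp(1)])
    show "K1 / n * (u s - drive p q \<rho> s) - K1 / n * u s
        \<le> - (D0 * (2 * h s * (1 - h s))) - K1 / n * (\<alpha> - D0 * h s)" for s
    proof -
      have hs: "0 \<le> h s" using h_bounds(1)[of s] by simp
      have "n \<le> k0 / 16" using K(1,4) n mult_right_mono[of 4 K n] by linarith
      \<comment> \<open>The moving barrier must also pay for its own slope, at most
        \<open>2 n D0 h\<close>. Half of \<open>k0 D0 = 4 c2\<close> covers the forcing
        \<open>2 c2\<close>, the other half covers this slope because
        \<open>n \<le> k0 / 16\<close>.\<close>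
      have "2 * c2 / k0 * (4 * n) \<le> 2 * c2 / k0 * k0"
        using \<open>n \<le> k0 / 16\<close> k0 by (intro mult_left_mono) auto
      then have "2 * n * D0 + 2 * c2 \<le> k0 * D0" using k0(1) by (simp add: field_simps)
      then have le: "K1 * D0 - k0 * D0 + 2 * c2 \<le> K1 * D0 - 2 * n * D0" by linarith
      have "k * ((1 - x / k) * D + y / k) = k * D - x * D + y" if "k \<noteq> 0" for k x y D :: real
        using that by (simp add: field_simps)
      then have eq: "K1 * ((1 - k0 / K1) * D0 + 2 * c2 / K1) = K1 * D0 - k0 * D0 + 2 * c2"
        using K1_pos by (metis less_irrefl)
      have "K1 * (h s * ((1 - k0 / K1) * D0 + 2 * c2 / K1))
          = h s * (K1 * ((1 - k0 / K1) * D0 + 2 * c2 / K1))"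
        by (rule mult.left_commute)
      also have "\<dots> \<le> h s * (K1 * D0 - 2 * n * D0)"
        unfolding eq using le hs by (rule mult_left_mono)
      finally have up: "K1 * (h s * ((1 - k0 / K1) * D0 + 2 * c2 / K1)) \<le> h s * (K1 * D0 - 2 * n * D0)" .
      have "K1 * (\<alpha> - h s * ((1 - k0 / K1) * D0 + 2 * c2 / K1)) \<le> K1 * drive p q \<rho> s"
        using db(3)[of s] K1_pos by (intro mult_left_mono) auto
      then have low: "K1 * \<alpha> - h s * (K1 * D0 - 2 * n * D0) \<le> K1 * drive p q \<rho> s"
        using up unfolding right_diff_distrib[of K1 \<alpha>] by linarith
      have alg: "k * (\<alpha> - D * y) + n * (D * (2 * y * (1 - y)))
          = k * \<alpha> - y * (k * D - 2 * n * D) - 2 * (n * D * (y * y))" for k D y :: real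
        by (simp add: algebra_simps)
      have "0 \<le> n * D0 * (h s * h s)" using n D0_nonneg hs by (intro mult_nonneg_nonneg) auto
      then have "K1 * (\<alpha> - D0 * h s) + n * (D0 * (2 * h s * (1 - h s))) \<le> K1 * drive p q \<rho> s"
        using low unfolding alg by linarith
      moreover have "k / n * (x - y) - k / n * x \<le> - z - k / n * w" if "k * w + n * z \<le> k * y" for k w x y z
      proof -
        have "(k * w + n * z) / n \<le> k * y / n" using that n by (intro divide_right_mono) auto
        then show ?thesis using n by (simp add: add_divide_distrib right_diff_distrib)
      qed
      ultimately show ?thesis by blast
    qed
  qed
  moreover have "continuous_on UNIV u"
    using u by (intro DERIV_continuous_on) (auto intro: has_field_derivative_at_within)
  ultimately have "admissible u" by (simp add: admissible_def)
  then show ?thesis using dr u by (auto simp: relaxed_def)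
qed

section \<open>Contraction in the weighted norm\<close>

text \<open>The direct dependence on \<open>\<rho>\<close> contracts by \<open>1 - k0 / K1\<close>.
  The part \<open>E\<close> passing through \<open>p\<close> and \<open>q\<close> has size at most
  \<open>k0 / 2 * X h \<phi>\<close> by the third bound on \<open>K\<close>, so half of the gain
  survives.\<close>

lemma drive_diff:
  assumes a1: "admissible \<rho>1" "driven_by \<rho>1 p1 q1" and a2: "admissible \<rho>2" "driven_by \<rho>2 p2 q2"
    and X: "0 \<le> X" "\<And>t. \<bar>\<rho>1 t - \<rho>2 t\<bar> \<le> X * (h t * \<phi> t)"
  shows "\<bar>drive p1 q1 \<rho>1 t - drive p2 q2 \<rho>2 t\<bar> \<le> (1 - k0 / (2 * K1)) * X * (h t * \<phi> t)"
proof -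
  note Kp = K1_pos
  have hp: "0 \<le> h t" "0 \<le> h t * \<phi> t" using h_bounds(1)[of t] phi_ge_1[of t] by auto
  obtain g where g: "k0 \<le> g" "g \<le> K1"
    "F (p1 t) (q1 t) (\<rho>1 t) - F (p1 t) (q1 t) (\<rho>2 t) = g * (\<rho>1 t - \<rho>2 t)"
    using F_diff[OF driven_p_le[OF a1(2,1), of t] admissibleD(2,3)[OF a1(1), of t]
        admissibleD(2,3)[OF a2(1), of t]] by blast
  define E where "E = F (p1 t) (q1 t) (\<rho>2 t) - F (p2 t) (q2 t) (\<rho>2 t)"
  \<comment> \<open>Writing both terms as exponentials, with \<open>ln c\<close> in place of
    \<open>\<rho>\<close>, keeps the factor \<open>h\<close> in the estimate.\<close>
  have pd: "\<bar>l * p1 t * c - l * p2 t * c\<bar> \<le> c2 * h t * \<bar>ln (p1 t) - ln (p2 t)\<bar>"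
  proof -
    have eq: "l * p t * c = exp (ln l + ln (p t) + ln c)" if "driven_by \<rho> p q" for \<rho> p q
      using l c drivenD(1)[OF that] by (simp add: exp_add)
    have "\<bar>l * p1 t * c - l * p2 t * c\<bar>
      \<le> c2 * h t * \<bar>(ln l + ln (p1 t) + ln c) - (ln l + ln (p2 t) + ln c)\<bar>"
      using driven_bounds(6)[OF a1(2,1), of t] driven_bounds(6)[OF a2(2,1), of t]
      unfolding eq[OF a1(2)] eq[OF a2(2)] by (rule abs_exp_diff_le)
    then show ?thesis by simp
  qed
  have "\<bar>E\<bar> \<le> \<bar>q1 t - q2 t\<bar> + \<bar>(l * p1 t - l * p2 t) * exp (\<rho>2 t)\<bar>"
    by (simp add: E_def F_def left_diff_distrib)
  also have "\<bar>(l * p1 t - l * p2 t) * exp (\<rho>2 t)\<bar> \<le> \<bar>l * p1 t - l * p2 t\<bar> * c"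
    unfolding abs_mult using admissible_bounds(2)[OF a2(1), of t] by (intro mult_left_mono) auto
  also have "\<bar>l * p1 t - l * p2 t\<bar> * c = \<bar>l * p1 t * c - l * p2 t * c\<bar>"
    using c by (simp add: abs_mult flip: left_diff_distrib)
  also have "\<dots> \<le> c2 * h t * \<bar>ln (p1 t) - ln (p2 t)\<bar>" by (rule pd)
  also have "\<dots> \<le> c2 * h t * (6 * c2 * X / K * \<phi> t)"
    using hp by (intro mult_left_mono driven_lipschitz(1)[OF a1 a2 X]) auto
  also have "\<dots> = 6 * c2\<^sup>2 * X / K * (h t * \<phi> t)" by (simp add: power2_eq_square)
  finally have "\<bar>E\<bar> \<le> 14 * c2\<^sup>2 * X / K * (h t * \<phi> t)"
    using driven_lipschitz(2)[OF a1 a2 X, of t] by (simp add: add_divide_distrib distrib_right)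
  also have "\<dots> \<le> k0 / 2 * X * (h t * \<phi> t)"
  proof (rule mult_right_mono)
    have "14 * c2\<^sup>2 * X \<le> K * k0 / 2 * X" using K(3) X(1) by (intro mult_right_mono) auto
    then show "14 * c2\<^sup>2 * X / K \<le> k0 / 2 * X" using K(1) by (simp add: field_simps)
  qed (use hp in auto)
  finally have E: "\<bar>E\<bar> \<le> k0 / 2 * X * (h t * \<phi> t)" .
  have "drive p1 q1 \<rho>1 t - drive p2 q2 \<rho>2 t = (1 - g / K1) * (\<rho>1 t - \<rho>2 t) - E / K1"
  proof -
    have "F (p1 t) (q1 t) (\<rho>1 t) - F (p2 t) (q2 t) (\<rho>2 t) = g * (\<rho>1 t - \<rho>2 t) + E"
      using g(3) by (simp add: E_def)
    then have "(F (p1 t) (q1 t) (\<rho>1 t) - F (p2 t) (q2 t) (\<rho>2 t)) / K1 = g * (\<rho>1 t - \<rho>2 t) / K1 + E / K1"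
      by (simp only: add_divide_distrib)
    then show ?thesis by (simp add: drive_def left_diff_distrib diff_divide_distrib)
  qed
  then have "\<bar>drive p1 q1 \<rho>1 t - drive p2 q2 \<rho>2 t\<bar>
      \<le> \<bar>(1 - g / K1) * (\<rho>1 t - \<rho>2 t)\<bar> + \<bar>E / K1\<bar>"
    by (simp only: abs_triangle_ineq4)
  also have "\<bar>(1 - g / K1) * (\<rho>1 t - \<rho>2 t)\<bar> \<le> (1 - k0 / K1) * (X * (h t * \<phi> t))"
    unfolding abs_mult
  proof (intro mult_mono X(2))
    have "0 \<le> 1 - g / K1" using g Kp by simp
    moreover have "k0 / K1 \<le> g / K1" using g Kp by (intro divide_right_mono) auto
    ultimately show "\<bar>1 - g / K1\<bar> \<le> 1 - k0 / K1" "0 \<le> 1 - k0 / K1" by linarith+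
  qed auto
  also have "\<bar>E / K1\<bar> \<le> k0 / 2 * X * (h t * \<phi> t) / K1"
    using divide_right_mono[OF E less_imp_le[OF Kp]] Kp by (simp only: abs_divide abs_of_pos)
  also have "(1 - k0 / K1) * (X * (h t * \<phi> t)) + k0 / 2 * X * (h t * \<phi> t) / K1
      = (1 - k0 / (2 * K1)) * X * (h t * \<phi> t)"
  proof -
    have "(1 - k0 / k) * (X * w) + k0 / 2 * X * w / k = (1 - k0 / (2 * k)) * X * w"
      if "k \<noteq> 0" for k w using that by (simp add: field_simps)
    then show ?thesis using Kp by (metis less_irrefl)
  qed
  finally show ?thesis by simp
qed

lemma phi_growth:
  assumes "K < k"
  shows "((\<lambda>t. exp (- (k * t)) * (h t * \<phi> t)) \<longlongrightarrow> 0) at_top"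
proof (rule Lim_null_comparison)
  show "((\<lambda>t. 2 powr (K / 2) * exp (- ((k - K) * t))) \<longlongrightarrow> 0) at_top"
    using tendsto_mult[OF tendsto_const exp_linear_tendsto_0_at_top[of "k - K"], of "2 powr (K / 2)"] assms
    by simp
  show "eventually (\<lambda>t. norm (exp (- (k * t)) * (h t * \<phi> t)) \<le> 2 powr (K / 2) * exp (- ((k - K) * t))) at_top"
    using eventually_ge_at_top[of 0]
  proof eventually_elim
    case (elim t)
    have "\<phi> t \<le> (2 * exp (2 * t)) powr (K / 2)"
      unfolding \<phi>_def using elim K(1) by (intro powr_mono2) (auto intro: add_nonneg_nonneg)
    also have "\<dots> = 2 powr (K / 2) * exp (K * t)"
      by (simp add: powr_mult exp_powr_real)
    finally have "h t * \<phi> t \<le> 1 * (2 powr (K / 2) * exp (K * t))"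
      using h_bounds[of t] phi_ge_1[of t] by (intro mult_mono) auto
    then have "exp (- (k * t)) * (h t * \<phi> t) \<le> exp (- (k * t)) * (2 powr (K / 2) * exp (K * t))"
      by (intro mult_left_mono) auto
    also have "\<dots> = 2 powr (K / 2) * exp (- ((k - K) * t))"
      by (simp add: algebra_simps flip: exp_add)
    finally show ?case using h_bounds(1)[of t] phi_ge_1[of t] by simp
  qed
qed

text \<open>With \<open>k = K1 / n\<close>, the factor \<open>k / (k - K)\<close> is the integral of
  \<open>k exp (- k r) exp (K r)\<close> over \<open>r \<ge> 0\<close>: the price of anticipation
  under a weight growing at rate \<open>K\<close>. The bound \<open>K n \<le> k0 / 4\<close> keeps
  the product below 1.\<close>

definition \<theta> :: real where
  "\<theta> = (1 - k0 / (2 * K1)) * (K1 / n) / (K1 / n - K)"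

lemma theta_bounds: "0 \<le> \<theta>" "\<theta> < 1"
proof -
  note kp = k_large and kk = k0_le_K1 and Kp = K1_pos
  have "0 \<le> 1 - k0 / (2 * K1)" using kk Kp by (simp add: field_simps)
  then have "0 \<le> (1 - k0 / (2 * K1)) * (K1 / n)" using kp(1) by (intro mult_nonneg_nonneg less_imp_le[OF kp(1)])
  then show "0 \<le> \<theta>" unfolding \<theta>_def using kp(2) by (intro divide_nonneg_nonneg) linarith+
  have "K * n < k0 / 2" using K(4) k0 by linarith
  then have "K < k0 / 2 / n" using n by (simp add: pos_less_divide_eq)
  moreover have "(1 - k0 / (2 * K1)) * (K1 / n) = K1 / n - k0 / 2 / n"
  proof -
    have "(1 - k0 / (2 * k)) * (k / n) = k / n - k0 / 2 / n" if "k \<noteq> 0" for k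
      using that n by (simp add: field_simps)
    then show ?thesis using Kp by (metis less_irrefl)
  qed
  ultimately show "\<theta> < 1" unfolding \<theta>_def using kp by (simp add: pos_divide_less_eq)
qed

text \<open>\<open>\<theta> X h \<phi>\<close> is a supersolution of the backward equation for
  \<open>u1 - u2\<close>: its logarithmic derivative \<open>2 - 2 h + K h\<close> is at most
  \<open>K\<close>, and \<open>\<theta> (k - K) = (1 - k0 / (2 K1)) k\<close>.\<close>

lemma relaxed_contraction_upper:
  assumes a1: "admissible \<rho>1" "relaxed \<rho>1 p1 q1 u1" and a2: "admissible \<rho>2" "relaxed \<rho>2 p2 q2 u2"
    and X: "0 \<le> X" "\<And>t. \<bar>\<rho>1 t - \<rho>2 t\<bar> \<le> X * (h t * \<phi> t)"
  shows "u1 t \<le> u2 t + \<theta> * X * (h t * \<phi> t)"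
proof -
  define k where "k = K1 / n"
  note kp = k_large[folded k_def]
  have dr: "driven_by \<rho>1 p1 q1" "driven_by \<rho>2 p2 q2" and ad: "admissible u1" "admissible u2"
    and u1: "\<And>t. (u1 has_real_derivative k * (u1 t - drive p1 q1 \<rho>1 t)) (at t)"
    and u2: "\<And>t. (u2 has_real_derivative k * (u2 t - drive p2 q2 \<rho>2 t)) (at t)"
    using a1 a2 by (auto simp: relaxed_def k_def)
  define bar where "bar = (\<lambda>t. \<theta> * X * (h t * \<phi> t))"
  have bar0: "0 \<le> bar t" for t
    using theta_bounds(1) X(1) h_bounds(1)[of t] phi_ge_1[of t] by (simp add: bar_def)
  have bar_deriv: "(bar has_real_derivative bar t * (2 - 2 * h t + K * h t)) (at t)" for t
    unfolding bar_def
    by (rule derivative_eq_intros h_deriv phi_deriv | simp)+ (simp add: algebra_simps)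
  have "u1 t \<le> u2 t + bar t"
  proof (rule backward_comparison[OF u1 DERIV_add[OF u2 bar_deriv]])
    have "\<bar>u2 s - u1 s\<bar> \<le> \<bar>\<alpha>\<bar> + \<bar>\<alpha>\<bar> + \<bar>\<alpha>0\<bar> + \<bar>\<alpha>0\<bar>" for s
      using admissibleD(2,3)[OF ad(1), of s] admissibleD(2,3)[OF ad(2), of s] by linarith
    then have "((\<lambda>t. exp (- (k * t)) * (u2 t - u1 t)) \<longlongrightarrow> 0) at_top"
      by (rule bounded_mult_exp_tendsto_0[OF kp(1)])
    moreover have "((\<lambda>t. exp (- (k * t)) * bar t) \<longlongrightarrow> 0) at_top"
      using tendsto_mult[OF tendsto_const phi_growth[OF kp(2)], of "\<theta> * X"]
      by (simp add: bar_def mult_ac)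
    ultimately have "((\<lambda>t. exp (- (k * t)) * (u2 t - u1 t) + exp (- (k * t)) * bar t) \<longlongrightarrow> 0 + 0) at_top"
      by (rule tendsto_add)
    then show "((\<lambda>t. exp (- (k * t)) * (u2 t + bar t - u1 t)) \<longlongrightarrow> 0) at_top"
      by (simp add: algebra_simps)
    fix s
    have "k * (drive p1 q1 \<rho>1 s - drive p2 q2 \<rho>2 s) \<le> k * ((1 - k0 / (2 * K1)) * X * (h s * \<phi> s))"
      using drive_diff[OF a1(1) dr(1) a2(1) dr(2) X, of s] kp(1) by (intro mult_left_mono) auto
    also have "\<dots> = bar s * (k - K)"
    proof -
      have eq: "\<theta> * (k - K) = (1 - k0 / (2 * K1)) * k"
        using kp unfolding \<theta>_def k_def[symmetric] by simp
      have "bar s * (k - K) = \<theta> * (k - K) * (X * (h s * \<phi> s))"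
        unfolding bar_def by (simp only: mult_ac)
      then show ?thesis unfolding eq by (simp only: mult_ac)
    qed
    also have "bar s * (k - K) \<le> bar s * (k - (2 - 2 * h s + K * h s))"
    proof (intro mult_left_mono bar0)
      have "(K - 2) * h s \<le> (K - 2) * 1" using K(1) h_bounds(2)[of s] by (intro mult_left_mono) auto
      then show "k - K \<le> k - (2 - 2 * h s + K * h s)" by (simp add: algebra_simps)
    qed
    finally show "k * (u2 s - drive p2 q2 \<rho>2 s) + bar s * (2 - 2 * h s + K * h s) - k * (u2 s + bar s)
        \<le> k * (u1 s - drive p1 q1 \<rho>1 s) - k * u1 s"
      by (simp add: algebra_simps)
  qed
  then show ?thesis by (simp add: bar_def)
qed

lemma orbit_exists:
  "\<exists>\<rho> p q. admissible \<rho> \<and> driven_by \<rho> p q \<and>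
    (\<forall>t. (\<rho> has_real_derivative F (p t) (q t) (\<rho> t) / n) (at t))"
proof -
  obtain P Q U where T: "\<And>\<rho>. admissible \<rho> \<Longrightarrow> relaxed \<rho> (P \<rho>) (Q \<rho>) (U \<rho>)"
    using relaxed_exists by metis
  have ad: "{f. continuous_on UNIV f \<and> (\<forall>t. max \<alpha>0 (\<alpha> - D0 * h t) \<le> f t \<and> f t \<le> \<alpha>)} = Collect admissible"
    by (auto simp: admissible_def)
  have hp: "0 < h t * \<phi> t" for t using h_bounds(1)[of t] phi_ge_1[of t] by simp
  have top_ad: "admissible (\<lambda>_. \<alpha>)"
    using alpha0_le mult_nonneg_nonneg[OF D0_nonneg less_imp_le[OF h_bounds(1)]] by (auto simp: admissible_def)
  have "\<exists>\<rho>\<in>{f. continuous_on UNIV f \<and> (\<forall>t. max \<alpha>0 (\<alpha> - D0 * h t) \<le> f t \<and> f t \<le> \<alpha>)}. U \<rho> = \<rho>"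
  proof (rule weighted_fixed_point, unfold ad)
    show "0 < h t * \<phi> t" for t by (rule hp)
    show "continuous_on UNIV (\<lambda>t. h t * \<phi> t)"
      using DERIV_isCont[OF h_deriv] DERIV_isCont[OF phi_deriv]
      by (auto simp: continuous_on_eq_continuous_at intro!: continuous_intros)
    show "(\<lambda>_. \<alpha>) \<in> Collect admissible" using top_ad by simp
    \<comment> \<open>The weight vanishes at \<open>-\<infinity>\<close> like
      \<open>exp (2 t)\<close>; the barrier \<open>\<alpha> - D0 h\<close> matches this
      rate.\<close>
    show "\<alpha> - max \<alpha>0 (\<alpha> - D0 * h t) \<le> D0 * (h t * \<phi> t)" for t
    proof -
      have "D0 * h t * 1 \<le> D0 * h t * \<phi> t"
        using D0_nonneg h_bounds(1)[of t] phi_ge_1[of t] by (intro mult_left_mono mult_nonneg_nonneg) auto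
      then have "D0 * h t \<le> D0 * (h t * \<phi> t)" by (simp only: mult.assoc mult_1_right)
      then show ?thesis by linarith
    qed
    show "U f \<in> Collect admissible" if "f \<in> Collect admissible" for f
      using T that by (auto simp: relaxed_def)
    show "0 \<le> \<theta>" "\<theta> < 1" using theta_bounds by auto
    fix f g X t assume fg: "f \<in> Collect admissible" "g \<in> Collect admissible"
      and X: "0 \<le> X" "\<And>t. \<bar>f t - g t\<bar> \<le> X * (h t * \<phi> t)"
    then have f: "admissible f" and g: "admissible g" by auto
    have "U f t \<le> U g t + \<theta> * X * (h t * \<phi> t)"
      by (rule relaxed_contraction_upper[OF f T[OF f] g T[OF g] X])
    moreover have "U g t \<le> U f t + \<theta> * X * (h t * \<phi> t)"
      by (rule relaxed_contraction_upper[OF g T[OF g] f T[OF f] X(1)]) (use X(2) in \<open>simp add: abs_minus_commute\<close>)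
    ultimately show "\<bar>U f t - U g t\<bar> \<le> \<theta> * X * (h t * \<phi> t)" by linarith
  qed simp
  then obtain \<rho> where \<rho>: "admissible \<rho>" "U \<rho> = \<rho>" unfolding ad by blast
  have "(\<rho> has_real_derivative F (P \<rho> t) (Q \<rho> t) (\<rho> t) / n) (at t)" for t
  proof -
    have "(\<rho> has_real_derivative K1 / n * (\<rho> t - drive (P \<rho>) (Q \<rho>) \<rho> t)) (at t)"
      using T[OF \<rho>(1)] \<rho>(2) by (auto simp: relaxed_def)
    moreover have "K1 / n * (\<rho> t - drive (P \<rho>) (Q \<rho>) \<rho> t) = F (P \<rho> t) (Q \<rho> t) (\<rho> t) / n"
      using K1_pos by (simp add: drive_def)
    ultimately show ?thesis by (simp only:)
  qed
  then show ?thesis using \<rho> T[OF \<rho>(1)] by (auto simp: relaxed_def)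
qed

end

subsection \<open>Limits of the orbit\<close>

locale slow_fast_orbit = slow_fast +
  fixes \<rho> p q :: "real \<Rightarrow> real"
  assumes adm: "admissible \<rho>" and driven: "driven_by \<rho> p q"
    and fast: "\<And>t. (\<rho> has_real_derivative F (p t) (q t) (\<rho> t) / n) (at t)"
begin

definition s :: "real \<Rightarrow> real" where
  "s t = l * p t * exp (\<rho> t)"

lemmas orbitD = drivenD[OF driven, folded s_def]
lemmas orbit_bounds = driven_bounds[OF driven adm, folded s_def]
lemmas rhoD = admissibleD[OF adm]

lemma F_eq: "F (p t) (q t) (\<rho> t) = q t + s t + d * R (\<rho> t) - (1 - b)"
  by (simp add: F_def s_def)

lemma d_less_1: "d < 1"
proof (rule ccontr)
  assume "\<not> d < 1"
  then have "1 * (1 + b) \<le> d * (1 + b)" using b by (intro mult_right_mono) auto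
  then show False using db b by simp
qed

section \<open>Limits at \<open>+\<infinity>\<close>\<close>

text \<open>In \<open>\<Phi>\<close> the terms with \<open>R\<close> and \<open>q + s\<close>
  cancel, leaving the derivative \<open>- (1 + d) b s / q \<le> 0\<close>. With
  \<open>ln q \<le> 0\<close> and \<open>\<rho> \<le> \<alpha>\<close>, \<open>ln p\<close> lies
  below a line of slope \<open>- (1 - d) / d\<close>.\<close>

lemma p_tendsto_0: "(p \<longlongrightarrow> 0) at_top"
proof -
  define \<Phi> where "\<Phi> = (\<lambda>t. d * ln (p t) - n * \<rho> t - 2 * d * t + (1 + d) * (t - ln (q t)))"
  have deriv: "(\<Phi> has_real_derivative - ((1 + d) * b * s t / q t)) (at t)" for t
  proof -
    have lnp: "((\<lambda>t. ln (p t)) has_real_derivative R (\<rho> t) + 1 - b - (q t + s t)) (at t)"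
      using orbitD(1)[of t] by (auto intro!: derivative_eq_intros orbitD(6))
    have lnq: "((\<lambda>t. ln (q t)) has_real_derivative 1 - (q t + s t) + b * s t / q t) (at t)"
      using orbitD(8)[of t] by (auto intro!: derivative_eq_intros orbitD(7) simp: add_divide_distrib)
    have "(\<Phi> has_real_derivative d * (R (\<rho> t) + 1 - b - (q t + s t)) - n * (F (p t) (q t) (\<rho> t) / n)
        - 2 * d + (1 + d) * (1 - (1 - (q t + s t) + b * s t / q t))) (at t)"
      unfolding \<Phi>_def by (rule derivative_eq_intros lnp lnq fast | simp)+
    moreover have "(1 + d) * (1 - b) = 2 * d" using db by (simp add: algebra_simps)
    then have "d * (R (\<rho> t) + 1 - b - (q t + s t)) - F (p t) (q t) (\<rho> t)
        - 2 * d + (1 + d) * (1 - (1 - (q t + s t) + w)) = - ((1 + d) * w)" for w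
      unfolding F_eq by (simp add: algebra_simps)
    from this[of "b * s t / q t"]
    have "d * (R (\<rho> t) + 1 - b - (q t + s t)) - n * (F (p t) (q t) (\<rho> t) / n)
        - 2 * d + (1 + d) * (1 - (1 - (q t + s t) + b * s t / q t)) = - ((1 + d) * b * s t / q t)"
      using n by (simp add: mult.assoc)
    ultimately show ?thesis by (simp only:)
  qed
  have "\<Phi> t \<le> \<Phi> 0" if "0 \<le> t" for t
  proof (rule DERIV_nonpos_imp_nonincreasing[OF that])
    fix x
    have "0 \<le> (1 + d) * b * s x / q x" using orbitD(8)[of x] orbit_bounds(5)[of x] b d by simp
    then show "\<exists>y. (\<Phi> has_real_derivative y) (at x) \<and> y \<le> 0" using deriv by fastforce
  qed
  then have le: "d * ln (p t) \<le> \<Phi> 0 + n * \<alpha> - (1 - d) * t" if "0 \<le> t" for t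
  proof -
    have "(1 + d) * ln (q t) \<le> 0"
      using orbitD(4,8)[of t] d by (intro mult_nonneg_nonpos) (auto simp: ln_le_zero_iff)
    moreover have "n * \<rho> t \<le> n * \<alpha>" using rhoD(3) n by (intro mult_left_mono) auto
    ultimately show ?thesis
      using \<open>0 \<le> t \<Longrightarrow> \<Phi> t \<le> \<Phi> 0\<close>[OF that] by (simp add: \<Phi>_def algebra_simps)
  qed
  define C where "C = (\<Phi> 0 + n * \<alpha>) / d"
  have "p t \<le> exp C * exp (- ((1 - d) / d * t))" if "0 \<le> t" for t
  proof -
    have "ln (p t) \<le> (\<Phi> 0 + n * \<alpha> - (1 - d) * t) / d"
      using le[OF that] d by (simp add: pos_le_divide_eq mult.commute)
    also have "\<dots> = C - (1 - d) / d * t" by (simp add: C_def diff_divide_distrib[of "\<Phi> 0 + n * \<alpha>"])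
    finally have "exp (ln (p t)) \<le> exp (C - (1 - d) / d * t)" by simp
    then show ?thesis using orbitD(1)[of t] by (simp add: exp_diff exp_minus divide_inverse)
  qed
  then have "eventually (\<lambda>t. norm (p t) \<le> exp C * exp (- ((1 - d) / d * t))) at_top"
    unfolding eventually_at_top_linorder using less_imp_le[OF orbitD(1)] by (intro exI[of _ 0]) auto
  moreover have "((\<lambda>t. exp C * exp (- ((1 - d) / d * t))) \<longlongrightarrow> 0) at_top"
    using tendsto_mult[OF tendsto_const exp_linear_tendsto_0_at_top[of "(1 - d) / d"], of "exp C"]
      d d_less_1 by simp
  ultimately show ?thesis by (rule Lim_null_comparison)
qed

lemma s_tendsto_0: "(s \<longlongrightarrow> 0) at_top"
proof (rule Lim_null_comparison)
  have "\<bar>s t\<bar> \<le> l * p t * c" for t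
    using orbitD(1)[of t] l admissible_bounds(2)[OF adm, of t] orbit_bounds(5)[of t]
    by (auto simp: s_def intro!: mult_left_mono)
  then show "eventually (\<lambda>t. norm (s t) \<le> l * p t * c) at_top" by simp
  show "((\<lambda>t. l * p t * c) \<longlongrightarrow> 0) at_top"
    by (auto intro!: tendsto_eq_intros p_tendsto_0)
qed

text \<open>\<open>x = 1 / q - 1\<close> linearises the logistic part:
  \<open>x' = s - (1 - s) x - b s / q\<^sup>2\<close>, a stable equation once
  \<open>s < 1 / 2\<close>.\<close>

lemma q_tendsto_1: "(q \<longlongrightarrow> 1) at_top"
proof -
  define x where "x = (\<lambda>t. 1 / q t - 1)"
  define x' where "x' = (\<lambda>t. - (q t * (1 - (q t + s t)) + b * s t) / (q t)\<^sup>2)"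
  have x0: "0 \<le> x t" for t using orbitD(4,8)[of t] by (simp add: x_def)
  have deriv: "(x has_real_derivative x' t) (at t)" for t
    unfolding x_def x'_def using orbitD(8)[of t]
    by (auto intro!: derivative_eq_intros orbitD(7) simp: power2_eq_square)
  have x'_le: "x' t \<le> s t - (1 - s t) * x t" for t
  proof -
    have "x' t = s t - (1 - s t) * x t - b * s t / (q t)\<^sup>2"
      using orbitD(8)[of t] by (simp add: x'_def x_def field_simps power2_eq_square)
    moreover have "0 \<le> b * s t / (q t)\<^sup>2" using b orbit_bounds(5)[of t] by simp
    ultimately show ?thesis by simp
  qed
  have "eventually (\<lambda>t. s t < 1 / 2) at_top" using s_tendsto_0 by (rule order_tendstoD) simp
  then have ev: "eventually (\<lambda>t. (x has_real_derivative x' t) (at t) \<and> x' t \<le> - (1 / 2) * x t + s t) at_top"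
  proof eventually_elim
    case (elim t)
    have "1 / 2 * x t \<le> (1 - s t) * x t" using elim x0 by (intro mult_right_mono) auto
    then have "x' t \<le> - (1 / 2) * x t + s t" using x'_le[of t] by linarith
    then show ?case using deriv by simp
  qed
  have "(x \<longlongrightarrow> 0) at_top"
  proof (rule order_tendstoI)
    show "eventually (\<lambda>t. y < x t) at_top" if "y < 0" for y using x0 that by (simp add: less_le_trans)
    show "eventually (\<lambda>t. x t < y) at_top" if "0 < y" for y
      by (rule limsup_le_0_if_stable[OF ev _ s_tendsto_0 that]) simp
  qed
  then have "((\<lambda>t. 1 / (1 + x t)) \<longlongrightarrow> 1 / (1 + 0)) at_top" by (intro tendsto_intros) auto
  moreover have "1 / (1 + x t) = q t" for t by (simp add: x_def)
  ultimately show ?thesis by simp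
qed

text \<open>\<open>\<beta>\<close> is the zero of \<open>F\<close> for \<open>q = 1\<close> and
  \<open>s = 0\<close>. The fast equation repels from it at rate at least \<open>k0 / n\<close> up
  to a vanishing error, so a bounded \<open>\<rho>\<close> can only converge to it.\<close>

lemma rho_tendsto_at_top:
  assumes \<beta>: "R \<beta> = - b / d"
  shows "(\<rho> \<longlongrightarrow> \<beta>) at_top"
proof -
  \<comment> \<open>\<open>bottom\<close> places \<open>\<beta>\<close> above
    \<open>\<alpha>0\<close>, so the slope bound \<open>k0\<close> is valid between
    \<open>\<rho> t\<close> and \<open>\<beta>\<close>.\<close>
  have "R \<alpha>0 < R \<beta>"
  proof -
    have "0 < exp \<alpha>0 / b" using b by simp
    then have "d * R \<alpha>0 < - b" using bottom unfolding R_def by linarith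
    then show ?thesis unfolding \<beta> pos_less_divide_eq[OF d(1)] by (simp only: mult.commute)
  qed
  moreover have "R \<beta> \<le> R \<alpha>"
  proof -
    have "R \<beta> < 0" using b d by (simp add: \<beta> divide_neg_pos)
    then show ?thesis using R_top b by simp
  qed
  ultimately have \<beta>': "\<alpha>0 \<le> \<beta>" "\<beta> \<le> \<alpha>"
    using R_mono[of \<beta> \<alpha>0] R_mono[of \<alpha> \<beta>] m l b
    by (auto simp: not_le[symmetric] R_def divide_le_cancel zero_less_mult_iff)
  define g where "g = (\<lambda>t. (\<alpha> - \<alpha>0) * (\<bar>q t - 1\<bar> + \<bar>s t\<bar>) / n)"
  have "((\<lambda>t. \<rho> t - \<beta>) \<longlongrightarrow> 0) at_top"
  proof (rule unstable_tendsto_0)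
    have bound: "\<bar>\<rho> t - \<beta>\<bar> \<le> (\<alpha> - \<alpha>0)" for t
      using rhoD(2,3)[of t] \<beta>' by (intro abs_leI) linarith+
    then show "eventually (\<lambda>t. \<bar>\<rho> t - \<beta>\<bar> \<le> (\<alpha> - \<alpha>0)) at_top" by simp
    show "0 < k0 / n" using k0 n by simp
    show "(g \<longlongrightarrow> 0) at_top"
    proof -
      have "((\<lambda>t. (\<alpha> - \<alpha>0) * (\<bar>q t - 1\<bar> + \<bar>s t\<bar>) / n) \<longlongrightarrow>
          (\<alpha> - \<alpha>0) * (\<bar>1 - 1\<bar> + \<bar>0\<bar>) / n) at_top"
        using n by (intro tendsto_intros q_tendsto_1 s_tendsto_0) auto
      then show ?thesis by (simp add: g_def)
    qed
    have "((\<lambda>t. \<rho> t - \<beta>) has_real_derivative F (p t) (q t) (\<rho> t) / n) (at t)" for t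
      using fast by (auto intro!: derivative_eq_intros)
    moreover have "k0 / n * (\<rho> t - \<beta>)\<^sup>2 - g t \<le> (\<rho> t - \<beta>) * (F (p t) (q t) (\<rho> t) / n)" for t
    proof -
      obtain \<gamma> where \<gamma>: "k0 \<le> d * \<gamma>" "R (\<rho> t) - R \<beta> = \<gamma> * (\<rho> t - \<beta>)"
        using R_diff[OF rhoD(2,3) \<beta>', of t] by metis
      have "d * R \<beta> = - b" using \<beta> d by simp
      moreover have "R (\<rho> t) = R \<beta> + \<gamma> * (\<rho> t - \<beta>)" using \<gamma>(2) by linarith
      ultimately have "d * R (\<rho> t) = d * \<gamma> * (\<rho> t - \<beta>) - b"
        by (simp only: distrib_left[of d "R \<beta>"])
      then have Feq: "F (p t) (q t) (\<rho> t) = (q t - 1 + s t) + d * \<gamma> * (\<rho> t - \<beta>)"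
        by (simp add: F_eq)
      have "k0 * (\<rho> t - \<beta>)\<^sup>2 \<le> d * \<gamma> * (\<rho> t - \<beta>)\<^sup>2" using \<gamma> by (intro mult_right_mono) auto
      moreover have "\<bar>(\<rho> t - \<beta>) * (q t - 1 + s t)\<bar> \<le> (\<alpha> - \<alpha>0) * (\<bar>q t - 1\<bar> + \<bar>s t\<bar>)"
        unfolding abs_mult using \<beta>' by (intro mult_mono bound) auto
      ultimately have "k0 * (\<rho> t - \<beta>)\<^sup>2 - (\<alpha> - \<alpha>0) * (\<bar>q t - 1\<bar> + \<bar>s t\<bar>)
          \<le> (\<rho> t - \<beta>) * F (p t) (q t) (\<rho> t)"
        unfolding Feq distrib_left power2_eq_square abs_le_iff
        by (simp only: mult.left_commute[of "\<rho> t - \<beta>" "d * \<gamma>"]) linarith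
      then have "(k0 * (\<rho> t - \<beta>)\<^sup>2 - (\<alpha> - \<alpha>0) * (\<bar>q t - 1\<bar> + \<bar>s t\<bar>)) / n
          \<le> (\<rho> t - \<beta>) * F (p t) (q t) (\<rho> t) / n"
        using n by (intro divide_right_mono) auto
      then show ?thesis by (simp add: g_def diff_divide_distrib)
    qed
    ultimately show "eventually (\<lambda>t. ((\<lambda>t. \<rho> t - \<beta>) has_real_derivative F (p t) (q t) (\<rho> t) / n) (at t) \<and>
        k0 / n * (\<rho> t - \<beta>)\<^sup>2 - g t \<le> (\<rho> t - \<beta>) * (F (p t) (q t) (\<rho> t) / n)) at_top" by simp
  qed
  then show ?thesis by (simp add: LIM_zero_iff)
qed

section \<open>Limits and exponential rates at \<open>-\<infinity>\<close>\<close>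

lemma rho_tendsto_at_bot: "(\<rho> \<longlongrightarrow> \<alpha>) at_bot"
proof (rule tendsto_sandwich)
  have "\<alpha> - D0 * h t \<le> \<rho> t" for t using rhoD(4)[of t] by linarith
  then show "eventually (\<lambda>t. \<alpha> - D0 * h t \<le> \<rho> t) at_bot" by simp
  show "((\<lambda>t. \<alpha> - D0 * h t) \<longlongrightarrow> \<alpha>) at_bot"
    using tendsto_diff[OF tendsto_const[of \<alpha>] tendsto_mult[OF tendsto_const[of D0] h_tendsto_0]] by simp
  show "eventually (\<lambda>t. \<rho> t \<le> \<alpha>) at_bot" using rhoD(3) by simp
qed simp

lemma p_scaled: "((\<lambda>t. exp (- 2 * t) * p t) \<longlongrightarrow> \<kappa>) at_bot"
proof -
  have "((\<lambda>t. exp (ln (p t) - 2 * t)) \<longlongrightarrow> exp (ln \<kappa>)) at_bot"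
    by (intro tendsto_exp driven_lim[OF driven])
  moreover have "exp (ln (p t) - 2 * t) = exp (- 2 * t) * p t" for t
    using orbitD(1)[of t] by (simp add: exp_diff exp_minus divide_inverse mult.commute)
  ultimately show ?thesis using \<kappa> by simp
qed

lemma s_scaled: "((\<lambda>t. exp (- 2 * t) * s t) \<longlongrightarrow> l * \<kappa> * exp \<alpha>) at_bot"
proof -
  have "((\<lambda>t. l * (exp (- 2 * t) * p t) * exp (\<rho> t)) \<longlongrightarrow> l * \<kappa> * exp \<alpha>) at_bot"
    by (intro tendsto_mult tendsto_const p_scaled tendsto_exp rho_tendsto_at_bot)
  then show ?thesis by (simp add: s_def mult_ac)
qed

lemma sigma_tendsto_0: "((\<lambda>t. q t + s t) \<longlongrightarrow> 0) at_bot"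
proof (rule Lim_null_comparison)
  have "norm (q t + s t) \<le> 2 * c2 * h t" for t
    using orbit_bounds(3,4,5)[of t] orbitD(8)[of t] by simp
  then show "eventually (\<lambda>t. norm (q t + s t) \<le> 2 * c2 * h t) at_bot" by simp
  show "((\<lambda>t. 2 * c2 * h t) \<longlongrightarrow> 0) at_bot"
    using tendsto_mult[OF tendsto_const h_tendsto_0, of "2 * c2"] by simp
qed

text \<open>\<open>y = exp (- 2 t) q\<close> solves \<open>y' = - (y - q0) + G\<close> with
  \<open>G\<close> tending to 0. Backward in time this repels from \<open>q0\<close>, while the
  upper barrier for \<open>q\<close> keeps \<open>y\<close> between 0 and \<open>q0\<close>.\<close>

lemma q_scaled: "((\<lambda>t. exp (- 2 * t) * q t) \<longlongrightarrow> b * (l * \<kappa> * exp \<alpha>)) at_bot"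
proof -
  define q0 where "q0 = b * (l * \<kappa> * exp \<alpha>)"
  define y where "y = (\<lambda>t. exp (- 2 * t) * q t)"
  have y: "0 \<le> y t" "y t \<le> q0" for t
  proof -
    have "exp (- 2 * t) * q t \<le> exp (- 2 * t) * (b * \<kappa> * l * exp \<alpha> * exp (2 * t))"
      using orbitD(5) by (intro mult_left_mono) auto
    then show "y t \<le> q0" by (simp add: y_def q0_def mult_ac exp_minus)
    show "0 \<le> y t" using orbitD(8)[of t] by (simp add: y_def)
  qed
  define G where "G = (\<lambda>t. - q0 - (q t + s t) * y t + b * (exp (- 2 * t) * s t))"
  have "((\<lambda>t. y t - q0) \<longlongrightarrow> 0) at_bot"
  proof (rule unstable_tendsto_0_at_bot)
    show "(0 :: real) < 1" by simp
    have bound: "\<bar>y t - q0\<bar> \<le> q0" for t using y[of t] by linarith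
    then show "eventually (\<lambda>t. \<bar>y t - q0\<bar> \<le> q0) at_bot" by simp
    have "((\<lambda>t. (q t + s t) * y t) \<longlongrightarrow> 0) at_bot"
    proof (rule Lim_null_comparison)
      have "norm ((q t + s t) * y t) \<le> \<bar>q t + s t\<bar> * q0" for t
        using y[of t] by (auto simp: abs_mult intro!: mult_left_mono)
      then show "eventually (\<lambda>t. norm ((q t + s t) * y t) \<le> \<bar>q t + s t\<bar> * q0) at_bot" by simp
      show "((\<lambda>t. \<bar>q t + s t\<bar> * q0) \<longlongrightarrow> 0) at_bot"
        using tendsto_mult[OF tendsto_rabs[OF sigma_tendsto_0] tendsto_const, of q0] by simp
    qed
    then have "(G \<longlongrightarrow> - q0 - 0 + b * (l * \<kappa> * exp \<alpha>)) at_bot"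
      unfolding G_def by (intro tendsto_add tendsto_diff tendsto_mult tendsto_const s_scaled)
    then have "(G \<longlongrightarrow> 0) at_bot" by (simp add: q0_def)
    from tendsto_mult[OF tendsto_const tendsto_rabs[OF this], of q0]
    show "((\<lambda>t. q0 * \<bar>G t\<bar>) \<longlongrightarrow> 0) at_bot" by simp
    have "((\<lambda>t. y t - q0) has_real_derivative - (y t - q0) + G t) (at t)" for t
    proof -
      have "((\<lambda>t. y t - q0) has_real_derivative
          exp (- 2 * t) * (q t * (1 - (q t + s t)) + b * s t) - 2 * y t) (at t)"
        unfolding y_def by (rule derivative_eq_intros orbitD(7) | simp)+
      moreover have "exp (- 2 * t) * (q t * (1 - (q t + s t)) + b * s t)
          = y t * (1 - (q t + s t)) + b * (exp (- 2 * t) * s t)"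
        by (simp add: y_def algebra_simps)
      moreover have "- (y t - q0) + G t
          = y t * (1 - (q t + s t)) + b * (exp (- 2 * t) * s t) - 2 * y t"
        by (simp add: G_def algebra_simps)
      ultimately show ?thesis by (simp only:)
    qed
    moreover have "(y t - q0) * (- (y t - q0) + G t) \<le> - 1 * (y t - q0)\<^sup>2 + q0 * \<bar>G t\<bar>" for t
    proof -
      have "(y t - q0) * G t \<le> \<bar>y t - q0\<bar> * \<bar>G t\<bar>" by (metis abs_ge_self abs_mult)
      also have "\<dots> \<le> q0 * \<bar>G t\<bar>" by (intro mult_right_mono bound) auto
      finally have "(y t - q0) * G t \<le> q0 * \<bar>G t\<bar>" .
      moreover have "(y t - q0) * (- (y t - q0) + G t) = - 1 * (y t - q0)\<^sup>2 + (y t - q0) * G t"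
        by (simp add: power2_eq_square algebra_simps)
      ultimately show ?thesis by linarith
    qed
    ultimately show "eventually (\<lambda>t. ((\<lambda>t. y t - q0) has_real_derivative - (y t - q0) + G t) (at t) \<and>
        (y t - q0) * (- (y t - q0) + G t) \<le> - 1 * (y t - q0)\<^sup>2 + q0 * \<bar>G t\<bar>) at_bot" by simp
  qed
  then show ?thesis by (simp add: LIM_zero_iff y_def q0_def)
qed

text \<open>\<open>y = exp (- 2 t) (\<rho> - \<alpha>)\<close> solves
  \<open>y' = \<nu> (y - y0) + G\<close>, and \<open>gap\<close> means \<open>\<nu> > 0\<close>, so
  the equation attracts to \<open>y0\<close> backward in time. Admissibility bounds
  \<open>y\<close>, which sends the nonlinear remainder in \<open>G\<close> to 0.\<close>

lemma r_scaled:
  assumes gap: "2 * n * l < d * exp (m * \<alpha>)"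
  shows "((\<lambda>t. exp (- 2 * t) * (exp (\<rho> t) - exp \<alpha>)) \<longlongrightarrow>
    - \<kappa> * ((1 + b) * (exp \<alpha>)\<^sup>2 * l\<^sup>2 / (d * exp (m * \<alpha>) - 2 * n * l))) at_bot"
proof -
  \<comment> \<open>\<open>\<nu>\<close> is the linearised fast rate minus 2,
    \<open>\<sigma>0\<close> the limit of \<open>exp (- 2 t) (q + s)\<close>, and \<open>y0\<close>
    balances \<open>\<nu> y0 + \<sigma>0 / n = 0\<close>.\<close>
  define \<nu> where "\<nu> = d * exp (m * \<alpha>) / (l * n) - 2"
  define \<sigma>0 where "\<sigma>0 = b * (l * \<kappa> * exp \<alpha>) + l * \<kappa> * exp \<alpha>"
  define y0 where "y0 = - (\<sigma>0 / n) / \<nu>"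
  have \<nu>: "0 < \<nu>" using gap n l by (simp add: \<nu>_def pos_less_divide_eq mult_ac)
  define y where "y = (\<lambda>t. exp (- 2 * t) * (\<rho> t - \<alpha>))"
  have yb: "\<bar>y t\<bar> \<le> D0" for t
  proof -
    have "\<alpha> - \<rho> t \<le> D0 * exp (2 * t)"
      using rhoD(4)[of t] mult_left_mono[OF h_bounds(3) D0_nonneg, of t] by linarith
    then have "exp (- 2 * t) * (\<alpha> - \<rho> t) \<le> exp (- 2 * t) * (D0 * exp (2 * t))" by (intro mult_left_mono) auto
    also have "\<dots> = D0" by (simp add: exp_minus)
    finally show ?thesis using rhoD(3)[of t] by (simp add: y_def abs_mult)
  qed
  obtain g where g: "\<And>x. R x - R \<alpha> = g x * (x - \<alpha>)" "isCont g \<alpha>" "g \<alpha> = exp (m * \<alpha>) / l"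
    using R_deriv[of \<alpha>] unfolding CARAT_DERIV by blast
  have glim: "((\<lambda>t. g (\<rho> t)) \<longlongrightarrow> exp (m * \<alpha>) / l) at_bot"
    using isCont_tendsto_compose[OF g(2) rho_tendsto_at_bot] g(3) by simp
  define G where "G = (\<lambda>t. (exp (- 2 * t) * q t + exp (- 2 * t) * s t - \<sigma>0) / n
      + d / n * ((g (\<rho> t) - exp (m * \<alpha>) / l) * y t))"
  have "((\<lambda>t. y t - y0) \<longlongrightarrow> 0) at_bot"
  proof (rule stable_tendsto_0_at_bot)
    show "0 < \<nu>" by (rule \<nu>)
    have "((\<lambda>t. (g (\<rho> t) - exp (m * \<alpha>) / l) * y t) \<longlongrightarrow> 0) at_bot"
    proof (rule Lim_null_comparison)
      have "norm ((g (\<rho> t) - exp (m * \<alpha>) / l) * y t) \<le> \<bar>g (\<rho> t) - exp (m * \<alpha>) / l\<bar> * D0" for t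
        unfolding real_norm_def abs_mult by (intro mult_left_mono yb) auto
      then show "eventually (\<lambda>t. norm ((g (\<rho> t) - exp (m * \<alpha>) / l) * y t)
          \<le> \<bar>g (\<rho> t) - exp (m * \<alpha>) / l\<bar> * D0) at_bot" by simp
      have "((\<lambda>t. g (\<rho> t) - exp (m * \<alpha>) / l) \<longlongrightarrow> 0) at_bot"
        using glim by (simp only: LIM_zero_iff)
      from tendsto_mult[OF tendsto_rabs[OF this] tendsto_const, of D0]
      show "((\<lambda>t. \<bar>g (\<rho> t) - exp (m * \<alpha>) / l\<bar> * D0) \<longlongrightarrow> 0) at_bot" by simp
    qed
    then have "(G \<longlongrightarrow> (b * (l * \<kappa> * exp \<alpha>) + l * \<kappa> * exp \<alpha> - \<sigma>0) / n + d / n * 0) at_bot"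
      unfolding G_def using n
      by (intro tendsto_add tendsto_divide tendsto_diff tendsto_mult tendsto_const s_scaled q_scaled) auto
    then have "(G \<longlongrightarrow> 0) at_bot" by (simp add: \<sigma>0_def)
    from tendsto_mult[OF tendsto_const tendsto_rabs[OF this], of "D0 + \<bar>y0\<bar>"]
    show "((\<lambda>t. (D0 + \<bar>y0\<bar>) * \<bar>G t\<bar>) \<longlongrightarrow> 0) at_bot" by simp
    have "((\<lambda>t. y t - y0) has_real_derivative \<nu> * (y t - y0) + G t) (at t)" for t
    proof -
      have dR: "d * R (\<rho> t) = 1 - b + d * (g (\<rho> t) * (\<rho> t - \<alpha>))"
      proof -
        have "R (\<rho> t) = (1 + b) + g (\<rho> t) * (\<rho> t - \<alpha>)" using g(1)[of "\<rho> t"] R_top by linarith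
        then show ?thesis by (simp only: distrib_left[of d "1 + b"] db)
      qed
      have "((\<lambda>t. y t - y0) has_real_derivative
          exp (- 2 * t) * (F (p t) (q t) (\<rho> t) / n) - 2 * y t) (at t)"
        unfolding y_def by (rule derivative_eq_intros fast | simp)+
      moreover have "exp (- 2 * t) * (F (p t) (q t) (\<rho> t) / n)
          = (exp (- 2 * t) * q t + exp (- 2 * t) * s t) / n + d / n * (g (\<rho> t) * y t)"
        unfolding F_eq dR y_def using n by (simp add: field_simps)
      moreover have "\<nu> * y0 = - (\<sigma>0 / n)" using \<nu> by (simp add: y0_def)
      then have "\<nu> * (y t - y0) + G t
          = (exp (- 2 * t) * q t + exp (- 2 * t) * s t) / n + d / n * (g (\<rho> t) * y t) - 2 * y t"
        unfolding right_diff_distrib G_def \<nu>_def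
        by (simp add: algebra_simps add_divide_distrib diff_divide_distrib)
      ultimately show ?thesis by (simp only:)
    qed
    moreover have "\<nu> * (y t - y0)\<^sup>2 - (D0 + \<bar>y0\<bar>) * \<bar>G t\<bar> \<le> (y t - y0) * (\<nu> * (y t - y0) + G t)" for t
    proof -
      have "- ((y t - y0) * G t) \<le> \<bar>y t - y0\<bar> * \<bar>G t\<bar>" by (metis abs_ge_minus_self abs_mult)
      also have "\<dots> \<le> (D0 + \<bar>y0\<bar>) * \<bar>G t\<bar>"
        using yb[of t] by (intro mult_right_mono) auto
      finally show ?thesis by (simp add: distrib_left power2_eq_square mult_ac)
    qed
    ultimately show "eventually (\<lambda>t. ((\<lambda>t. y t - y0) has_real_derivative \<nu> * (y t - y0) + G t) (at t) \<and>
        \<nu> * (y t - y0)\<^sup>2 - (D0 + \<bar>y0\<bar>) * \<bar>G t\<bar> \<le> (y t - y0) * (\<nu> * (y t - y0) + G t)) at_bot" by simp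
  qed
  then have ylim: "(y \<longlongrightarrow> y0) at_bot" by (simp add: LIM_zero_iff)
  \<comment> \<open>The continuous slope of \<open>exp\<close> at \<open>\<alpha>\<close> transfers
    the limit from \<open>\<rho>\<close> to \<open>r = exp \<rho>\<close>.\<close>
  obtain e where e: "\<And>x. exp x - exp \<alpha> = e x * (x - \<alpha>)" "isCont e \<alpha>" "e \<alpha> = exp \<alpha>"
    using DERIV_exp[of \<alpha>] unfolding CARAT_DERIV by blast
  have "((\<lambda>t. e (\<rho> t) * y t) \<longlongrightarrow> exp \<alpha> * y0) at_bot"
    using tendsto_mult[OF isCont_tendsto_compose[OF e(2) rho_tendsto_at_bot] ylim] e(3) by simp
  moreover have "e (\<rho> t) * y t = exp (- 2 * t) * (exp (\<rho> t) - exp \<alpha>)" for t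
    unfolding e(1) by (simp add: y_def)
  moreover have "exp \<alpha> * y0 = - \<kappa> * ((1 + b) * (exp \<alpha>)\<^sup>2 * l\<^sup>2 / (d * exp (m * \<alpha>) - 2 * n * l))"
  proof -
    define W where "W = d * exp (m * \<alpha>) - 2 * n * l"
    have "W \<noteq> 0" using gap by (simp add: W_def)
    have "\<nu> = W / (l * n)" using n l by (simp add: \<nu>_def W_def field_simps)
    then have "y0 = - (\<sigma>0 / n) / (W / (l * n))" by (simp only: y0_def)
    also have "\<dots> = - (\<sigma>0 * l / W)" using n l \<open>W \<noteq> 0\<close> by (simp add: field_simps)
    finally have y0_eq: "y0 = - (\<sigma>0 * l / W)" .
    have "exp \<alpha> * y0 = - \<kappa> * ((1 + b) * (exp \<alpha>)\<^sup>2 * l\<^sup>2 / W)"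
      unfolding y0_eq \<sigma>0_def using \<open>W \<noteq> 0\<close> by (simp add: field_simps power2_eq_square)
    then show ?thesis by (simp only: W_def)
  qed
  ultimately show ?thesis by simp
qed

end

subsection \<open>The heteroclinic orbit\<close>

lemma heteroclinic_orbit_if_slow_fast:
  assumes \<Lambda>: "(m, n, l) \<in> Lambda" and n: "0 < n"
    and sf: "slow_fast m n l (a m n - 1) (m - n) (kappa m n l) (ln (A m n l)) \<alpha>0 c k0 K"
  shows "\<exists>x. heteroclinic_orbit m n l (M0 m n l) (M1 m n l) x \<and>
    ((\<lambda>\<eta>. exp (- 2 * \<eta>) *\<^sub>R (x \<eta> - M0 m n l)) \<longlongrightarrow> kappa m n l *\<^sub>R X01 m n l) at_bot"
proof -
  define d where "d = m - n"
  define b where "b = a m n - 1"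
  have m: "0 < m" and d: "0 < d" "d < 1" and l: "0 < l" "l < d * (1 + d) / (m * (1 - d))"
    and gap: "0 < d * (1 + 2 * m / (1 + d) * l) - 2 * n * l"
    using \<Lambda> by (auto simp: Lambda_def d_def algebra_simps)
  have a_eq: "a m n = 1 + b" "2 / (1 + d) = 1 + b" "2 / (1 + m - n) = 1 + b"
    by (simp_all add: b_def a_def d_def add_diff_eq)
  have b_eq: "b = (1 - d) / (1 + d)"
    using a_eq(2) d by (simp add: field_simps)
  have b: "0 < b" "b < 1" using d by (auto simp: b_eq)
  have db: "d * (1 + b) = 1 - b" using d by (simp add: b_eq field_simps)
  have A_eq: "A m n l = (1 + m * (1 + b) * l) powr (1 / m)"
    using a_eq(3) by (simp add: A_def mult.commute) (metis mult.commute times_divide_eq_right)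
  have Apos: "0 < 1 + m * (1 + b) * l" using m b l by (simp add: add_pos_pos)
  have A0: "0 < A m n l" using Apos by (simp add: A_eq)
  have Am: "A m n l powr m = 1 + m * (1 + b) * l" using Apos m by (simp add: A_eq powr_powr)
  have B_eq: "B m n l = (1 - m * b * l / d) powr (1 / m)"
    using a_eq(3) by (simp add: B_def d_def)
  \<comment> \<open>The upper bound on \<open>l\<close> in \<open>Lambda\<close> is equivalent to
    \<open>m b l < d\<close>, the positivity of the base of \<open>B\<close>.\<close>
  have Bpos: "0 < 1 - m * b * l / d"
  proof -
    have "l * (m * (1 - d)) < d * (1 + d)" using l(2) m d by (simp add: pos_less_divide_eq)
    then have "m * b * l < d" using d by (simp add: b_eq pos_divide_less_eq mult_ac)
    then show ?thesis using d by simp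
  qed
  have B0: "0 < B m n l" unfolding B_eq powr_gt_zero using Bpos by linarith
  have Bm: "B m n l powr m = 1 - m * b * l / d" using Bpos m by (simp add: B_eq powr_powr)
  interpret sf: slow_fast m n l b d "kappa m n l" "ln (A m n l)" \<alpha>0 c k0 K
    using sf by (simp only: b_def d_def)
  obtain \<rho> p q where orb: "sf.admissible \<rho>" "sf.driven_by \<rho> p q"
    "\<And>t. (\<rho> has_real_derivative sf.F (p t) (q t) (\<rho> t) / n) (at t)"
    using sf.orbit_exists by blast
  interpret so: slow_fast_orbit m n l b d "kappa m n l" "ln (A m n l)" \<alpha>0 c k0 K \<rho> p q
    using orb by unfold_locales
  have R_eq: "sf.R x = (exp x powr m - 1) / (m * l)" for x
    by (simp add: sf.R_def exp_powr_real mult.commute)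
  \<comment> \<open>The identity \<open>2 (m - n) / (1 + m - n) = d (1 + b) = 1 - b\<close> brings
    the system into slow-fast form.\<close>
  have rhs_eq: "rhs m n l (P, Q, r) =
      (P * ((r powr m - 1) / (m * l) + 1 - b - (Q + l * P * r)),
       Q * (1 - (Q + l * P * r)) + b * (l * P * r),
       r * (Q + l * P * r + d * ((r powr m - 1) / (m * l)) - (1 - b)))" for P Q r
  proof -
    have "2 * (m - n) / (1 + m - n) = d * (2 / (1 + m - n))" by (simp add: d_def)
    then have eq: "2 * (m - n) / (1 + m - n) = 1 - b" unfolding a_eq(3) db .
    have eq': "2 / (1 + m - n) - 1 = b" using a_eq(3) by simp
    show ?thesis
      unfolding rhs.simps eq eq' unfolding d_def[symmetric] by (simp add: algebra_simps diff_divide_distrib)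
  qed
  define x where "x = (\<lambda>\<eta>. (p \<eta>, q \<eta>, exp (\<rho> \<eta>)))"
  have M0: "equilibrium m n l (M0 m n l)"
  proof -
    have "(A m n l powr m - 1) / (m * l) = 1 + b" using m l by (simp add: Am)
    then show ?thesis
      using A0 db by (simp add: equilibrium_def phase_space_def M0_def rhs_eq del: rhs.simps)
  qed
  have M1: "equilibrium m n l (M1 m n l)"
  proof -
    have "d * ((B m n l powr m - 1) / (m * l)) = - b" using m l d by (simp add: Bm)
    then show ?thesis
      using B0 by (simp add: equilibrium_def phase_space_def M1_def rhs_eq del: rhs.simps)
  qed
  have sol: "global_solution m n l x"
    unfolding global_solution_def
  proof (intro allI conjI exI)
    fix t
    show "x t \<in> phase_space" by (simp add: x_def phase_space_def)
    define p' where "p' = p t * (sf.R (\<rho> t) + 1 - b - (q t + so.s t))"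
    define q' where "q' = q t * (1 - (q t + so.s t)) + b * so.s t"
    define r' where "r' = exp (\<rho> t) * (sf.F (p t) (q t) (\<rho> t) / n)"
    have "((\<lambda>t. exp (\<rho> t)) has_real_derivative r') (at t)"
      unfolding r'_def by (auto intro!: derivative_eq_intros so.fast)
    then show "(x has_vector_derivative (p', q', r')) (at t)"
      unfolding x_def p'_def q'_def using so.orbitD(6,7)[of t]
      by (intro has_vector_derivative_Pair) (auto simp: has_real_derivative_iff_has_vector_derivative)
    show "(p', q', n * r') = rhs m n l (x t)"
      unfolding x_def rhs_eq p'_def q'_def r'_def so.F_eq R_eq so.s_def using n by simp
  qed
  have "sf.R (ln (B m n l)) = - b / d"
    using B0 m l d by (simp add: R_eq Bm field_simps)
  then have "(\<rho> \<longlongrightarrow> ln (B m n l)) at_top" by (rule so.rho_tendsto_at_top)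
  from tendsto_exp[OF this] have "((\<lambda>t. exp (\<rho> t)) \<longlongrightarrow> B m n l) at_top" using B0 by simp
  then have lim_top: "(x \<longlongrightarrow> M1 m n l) at_top"
    unfolding x_def M1_def by (intro tendsto_Pair so.p_tendsto_0 so.q_tendsto_1)
  have null: "((\<lambda>t. f t) \<longlongrightarrow> 0) at_bot" if "((\<lambda>t. exp (- 2 * t) * f t) \<longlongrightarrow> L) at_bot" for f :: "real \<Rightarrow> real" and L
  proof -
    have "((\<lambda>t. exp (2 * t) * (exp (- 2 * t) * f t)) \<longlongrightarrow> 0 * L) at_bot"
      by (intro tendsto_mult sf.exp2_tendsto_0 that)
    moreover have "exp (2 * t) * (exp (- 2 * t) * f t) = f t" for t
      by (simp flip: exp_add mult.assoc)
    ultimately show ?thesis by (simp only: mult_zero_left)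
  qed
  have "((\<lambda>t. exp (\<rho> t)) \<longlongrightarrow> A m n l) at_bot"
    using tendsto_exp[OF so.rho_tendsto_at_bot] A0 by simp
  then have lim_bot: "(x \<longlongrightarrow> M0 m n l) at_bot"
    unfolding x_def M0_def by (intro tendsto_Pair null[OF so.p_scaled] null[OF so.q_scaled])
  have "M0 m n l \<noteq> M1 m n l" by (simp add: M0_def M1_def)
  then have "heteroclinic_orbit m n l (M0 m n l) (M1 m n l) x"
    using M0 M1 sol lim_top lim_bot by (simp add: heteroclinic_orbit_def)
  moreover have "((\<lambda>\<eta>. exp (- 2 * \<eta>) *\<^sub>R (x \<eta> - M0 m n l)) \<longlongrightarrow> kappa m n l *\<^sub>R X01 m n l) at_bot"
  proof -
    have Em: "exp (m * ln (A m n l)) = A m n l powr m" using A0 by (simp add: powr_def)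
    \<comment> \<open>This is the last condition of \<open>Lambda\<close>; it makes the denominator
      in \<open>X01\<close> positive.\<close>
    have "2 * n * l < d * exp (m * ln (A m n l))"
      using gap unfolding Em Am a_eq(2)[symmetric] by (simp add: mult_ac)
    from so.r_scaled[OF this]
    have "((\<lambda>t. exp (- 2 * t) * (exp (\<rho> t) - A m n l)) \<longlongrightarrow>
        kappa m n l * - (a m n * (A m n l)\<^sup>2 * l\<^sup>2 / ((m - n) * A m n l powr m - 2 * n * l))) at_bot"
      using A0 unfolding Em a_eq(1) by (simp add: d_def)
    moreover have "((\<lambda>t. exp (- 2 * t) * q t) \<longlongrightarrow> kappa m n l * ((a m n - 1) * A m n l * l)) at_bot"
      using so.q_scaled A0 by (simp add: a_eq(1) mult_ac)
    moreover have "((\<lambda>t. exp (- 2 * t) * p t) \<longlongrightarrow> kappa m n l * 1) at_bot"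
      using so.p_scaled by simp
    ultimately have "((\<lambda>t. (exp (- 2 * t) * p t, exp (- 2 * t) * q t, exp (- 2 * t) * (exp (\<rho> t) - A m n l)))
        \<longlongrightarrow> (kappa m n l * 1, kappa m n l * ((a m n - 1) * A m n l * l),
          kappa m n l * - (a m n * (A m n l)\<^sup>2 * l\<^sup>2 / ((m - n) * A m n l powr m - 2 * n * l)))) at_bot"
      by (intro tendsto_Pair)
    then show ?thesis by (simp add: x_def M0_def X01_def)
  qed
  ultimately show ?thesis by blast
qed

section \<open>Constants independent of \<open>n\<close>\<close>

text \<open>The order of choice matters: the barrier and bounds come from \<open>n = 0\<close> with
  a margin, \<open>K\<close> depends on \<open>c\<close> and \<open>k0\<close>, and only then is
  \<open>n\<close> made small in terms of \<open>K\<close>.\<close>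

lemma uniform_constants:
  assumes \<Lambda>0: "(m, 0, l) \<in> Lambda"
  shows "\<exists>n0>0. \<exists>\<alpha>0 c k0 K. \<forall>n. 0 < n \<and> n < n0 \<longrightarrow>
    slow_fast m n l (a m n - 1) (m - n) (kappa m n l) (ln (A m n l)) \<alpha>0 c k0 K"
proof -
  have m: "0 < m" "m < 1" and l: "0 < l" "l < (1 + m) / (1 - m)"
    using \<Lambda>0 by (auto simp: Lambda_def)
  \<comment> \<open>\<open>f n = b - d / (m l)\<close> is the limit of \<open>F\<close> as
    \<open>\<rho>\<close> tends to \<open>-\<infinity>\<close> in the worst case
    \<open>q = 1\<close>. At \<open>n = 0\<close> it equals \<open>- \<delta>\<close>, and
    \<open>\<delta> > 0\<close> is the upper bound on \<open>l\<close>.\<close>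
  define f where "f = (\<lambda>n. (1 - m + n) / (1 + m - n) - (m - n) / (m * l))"
  define b0 where "b0 = (1 - m) / (1 + m)"
  define \<delta> where "\<delta> = 1 / l - b0"
  have b0: "0 < b0" using m by (simp add: b0_def)
  have \<delta>: "0 < \<delta>" 
  proof -
    have "(1 - m) * l < 1 + m" using l m by (simp add: pos_less_divide_eq mult.commute)
    then have "1 - m < (1 + m) / l" using l by (simp add: pos_less_divide_eq)
    then have "b0 < 1 / l" using m by (simp add: b0_def pos_divide_less_eq)
    then show ?thesis by (simp add: \<delta>_def)
  qed
  have "(f \<longlongrightarrow> f 0) (at_right 0)"
    unfolding f_def using m l by (intro tendsto_intros) auto
  moreover have "f 0 = - \<delta>" using m by (simp add: f_def \<delta>_def b0_def)
  then have "f 0 < - \<delta> / 2" using \<delta> by linarith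
  ultimately have "eventually (\<lambda>n. f n < - \<delta> / 2) (at_right 0)" by (rule order_tendstoD)
  then obtain n1 where n1: "0 < n1" "\<And>n. 0 < n \<Longrightarrow> n < n1 \<Longrightarrow> f n < - \<delta> / 2"
    by (auto simp: eventually_at_right_field)
  \<comment> \<open>The margin \<open>\<delta> / 2\<close> left by \<open>n1\<close> is split evenly
    between \<open>exp \<alpha>0 / b\<close> and the exponential part of \<open>d R\<close>.\<close>
  define \<alpha>0 where "\<alpha>0 = min (ln (b0 * \<delta> / 4)) (ln (l * \<delta> / 4) / m)"
  have \<alpha>0: "exp \<alpha>0 \<le> b0 * \<delta> / 4" "exp (m * \<alpha>0) \<le> l * \<delta> / 4"
  proof -
    have "exp \<alpha>0 \<le> exp (ln (b0 * \<delta> / 4))" by (simp add: \<alpha>0_def)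
    then show "exp \<alpha>0 \<le> b0 * \<delta> / 4" using b0 \<delta> by simp
    have "m * \<alpha>0 \<le> m * (ln (l * \<delta> / 4) / m)" unfolding \<alpha>0_def using m by (intro mult_left_mono) auto
    then have "exp (m * \<alpha>0) \<le> exp (ln (l * \<delta> / 4))" using m by simp
    then show "exp (m * \<alpha>0) \<le> l * \<delta> / 4" using l \<delta> by simp
  qed
  \<comment> \<open>One summand for each quantity that \<open>c\<close> must dominate, using
    \<open>1 + b \<le> 2\<close> and \<open>b0 \<le> b\<close>.\<close>
  define c where "c = 1 + (1 + 2 * m * l) powr (1 / m) + 1 / b0 + l + (1 + 2 * m * l) / l"
  define k0 where "k0 = m / 2 * (exp (m * \<alpha>0) / l)"
  define K where "K = 4 + 8 * c\<^sup>2 + 28 * (2 * c\<^sup>2)\<^sup>2 / k0"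
  have c_ge: "1 \<le> c" "(1 + 2 * m * l) powr (1 / m) \<le> c" "1 / b0 \<le> c" "l \<le> c" "(1 + 2 * m * l) / l \<le> c"
    using b0 l m by (simp_all add: c_def add_nonneg_nonneg)
  have k0: "0 < k0" using m l by (simp add: k0_def)
  have K: "4 \<le> K" "8 * c\<^sup>2 \<le> K" "28 * (2 * c\<^sup>2)\<^sup>2 \<le> K * k0"
    using k0 by (auto simp: K_def field_simps)
  \<comment> \<open>\<open>n1\<close> secures the lower barrier, \<open>m / 2\<close> gives
    \<open>d \<ge> m / 2\<close> as used in \<open>k0\<close>, and the last bound is
    \<open>K n \<le> k0 / 4\<close>.\<close>
  have "slow_fast m n l (a m n - 1) (m - n) (kappa m n l) (ln (A m n l)) \<alpha>0 c k0 K"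
    if n: "0 < n" "n < min n1 (min (m / 2) (k0 / (4 * K)))" for n
  proof -
    define d where "d = m - n"
    define b where "b = a m n - 1"
    have d: "0 < d" "m / 2 \<le> d" "d \<le> m" using n by (auto simp: d_def)
    have b_eq: "b = (1 - d) / (1 + d)" using d by (simp add: b_def a_def d_def field_simps)
    have b: "0 < b" "b < 1" using d m by (auto simp: b_eq)
    have "b0 \<le> b"
      unfolding b_eq b0_def using d m by (intro frac_le) auto
    have db: "d * (1 + b) = 1 - b" using d by (simp add: b_eq field_simps)
    have a_eq: "2 / (1 + m - n) = 1 + b" by (simp add: b_def a_def)
    have A_eq: "A m n l = (1 + m * (1 + b) * l) powr (1 / m)"
      using a_eq by (simp add: A_def mult.commute) (metis mult.commute times_divide_eq_right)
    have "0 \<le> m * (1 + b) * l" using m b l by simp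
    have A_ge: "1 \<le> A m n l" unfolding A_eq using \<open>0 \<le> m * (1 + b) * l\<close> m by (intro ge_one_powr_ge_zero) auto
    have expA: "exp (m * ln (A m n l)) = 1 + m * (1 + b) * l"
    proof -
      have "exp (m * ln (A m n l)) = A m n l powr m" using A_ge by (simp add: powr_def)
      then show ?thesis using \<open>0 \<le> m * (1 + b) * l\<close> m by (simp add: A_eq powr_powr)
    qed
    have A_le: "1 + m * (1 + b) * l \<le> 1 + 2 * m * l"
      using m b l mult_mono[of "1 + b" 2 "m * l" "m * l"] by (simp add: mult_ac)
    show ?thesis
      unfolding b_def[symmetric] d_def[symmetric]
    proof
      show "0 < m" "0 < n" "0 < l" "0 < b" "b < 1" "0 < d" "d \<le> 1" "d * (1 + b) = 1 - b"
        "1 \<le> c" "l \<le> c" "0 < k0" "4 \<le> K" "8 * c\<^sup>2 \<le> K" "28 * (2 * c\<^sup>2)\<^sup>2 \<le> K * k0"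
        using m n l b d db c_ge k0 K by auto
      show "0 < kappa m n l" using A_ge by (simp add: kappa_def)
      show "kappa m n l \<le> 1" using A_ge n by (simp add: kappa_def powr_minus_divide ge_one_powr_ge_zero)
      show "exp (m * ln (A m n l)) - 1 = (1 + b) * (m * l)" by (simp add: expA)
      show "exp (ln (A m n l)) \<le> c"
      proof -
        have "A m n l \<le> (1 + 2 * m * l) powr (1 / m)"
          unfolding A_eq using A_le \<open>0 \<le> m * (1 + b) * l\<close> m by (intro powr_mono2) auto
        then show ?thesis using A_ge c_ge(2) by simp
      qed
      have "1 / b \<le> 1 / b0" using \<open>b0 \<le> b\<close> b0 by (intro divide_left_mono) auto
      then show "1 / b \<le> c" using c_ge(3) by linarith
      have "(1 + m * (1 + b) * l) / l \<le> (1 + 2 * m * l) / l" using A_le l by (intro divide_right_mono) auto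
      then show "exp (m * ln (A m n l)) / l \<le> c" using c_ge(5) expA by simp
      show "k0 \<le> d * (exp (m * \<alpha>0) / l)" unfolding k0_def using d l by (intro mult_right_mono) auto
      have "n < k0 / (4 * K)" using n by simp
      then show "K * n \<le> k0 / 4" using K(1) by (simp add: pos_less_divide_eq mult_ac)
      show "b + exp \<alpha>0 / b + d * ((exp (m * \<alpha>0) - 1) / (m * l)) \<le> 0"
      proof -
        have "f n < - \<delta> / 2" using n n1 by simp
        then have "b - d / (m * l) < - \<delta> / 2" by (simp add: f_def b_eq d_def algebra_simps)
        moreover have "exp \<alpha>0 / b \<le> \<delta> / 4"
        proof -
          have "exp \<alpha>0 / b \<le> exp \<alpha>0 / b0" using \<open>b0 \<le> b\<close> b0 by (intro divide_left_mono) auto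
          also have "\<dots> \<le> \<delta> / 4" using \<alpha>0(1) b0 by (simp add: pos_divide_le_eq mult_ac)
          finally show ?thesis .
        qed
        moreover have "d * (exp (m * \<alpha>0) / (m * l)) \<le> \<delta> / 4"
        proof -
          have "d * (exp (m * \<alpha>0) / (m * l)) \<le> m * (exp (m * \<alpha>0) / (m * l))"
            using d m l by (intro mult_right_mono) auto
          also have "\<dots> = exp (m * \<alpha>0) / l" using m by simp
          also have "\<dots> \<le> \<delta> / 4" using \<alpha>0(2) l by (simp add: pos_divide_le_eq mult_ac)
          finally show ?thesis .
        qed
        moreover have "d * ((exp (m * \<alpha>0) - 1) / (m * l)) = d * (exp (m * \<alpha>0) / (m * l)) - d / (m * l)"
          by (simp add: diff_divide_distrib right_diff_distrib)
        ultimately show ?thesis by linarith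
      qed
    qed
  qed
  moreover have "0 < min n1 (min (m / 2) (k0 / (4 * K)))" using n1 m k0 K(1) by simp
  ultimately show ?thesis by blast
qed

theorem theorem8p1:
  fixes m l :: real
  assumes "(m, 0, l) \<in> Lambda"
  shows "\<exists>n0>0. \<forall>n. 0 < n \<and> n < n0 \<and> (m, n, l) \<in> Lambda \<longrightarrow>
    (\<exists>x :: real \<Rightarrow> real \<times> real \<times> real.
       heteroclinic_orbit m n l (M0 m n l) (M1 m n l) x \<and>
       ((\<lambda>\<eta>. exp (- 2 * \<eta>) *\<^sub>R (x \<eta> - M0 m n l)) \<longlongrightarrow> kappa m n l *\<^sub>R X01 m n l) at_bot)"
proof -
  obtain n0 \<alpha>0 c k0 K where n0: "0 < n0" and
    sf: "\<And>n. 0 < n \<Longrightarrow> n < n0 \<Longrightarrow>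
      slow_fast m n l (a m n - 1) (m - n) (kappa m n l) (ln (A m n l)) \<alpha>0 c k0 K"
    using uniform_constants[OF assms] by blast
  show ?thesis
  proof (intro exI[of _ n0] conjI allI impI n0)
    fix n assume "0 < n \<and> n < n0 \<and> (m, n, l) \<in> Lambda"
    then show "\<exists>x. heteroclinic_orbit m n l (M0 m n l) (M1 m n l) x \<and>
        ((\<lambda>\<eta>. exp (- 2 * \<eta>) *\<^sub>R (x \<eta> - M0 m n l)) \<longlongrightarrow> kappa m n l *\<^sub>R X01 m n l) at_bot"
      using sf by (intro heteroclinic_orbit_if_slow_fast[of m n l \<alpha>0 c k0 K]) auto
  qed
qed

end
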